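(* Let $n\ge 2$ and $l\ge 1$ be integers and let $M(z,\bar z)$ be a non-zero bihomogeneous Hermitian polynomial of bidegree $(d,d)$ on $\mathbb C^n$ with signature $(p,q)$. Suppose $M(z,\bar z)\|z\|^{2l}=\|h\|^2$ for some holomorphic polynomial mapping $h$, and let $R$ be the rank of $\|h\|^2$. Then $$(p+q)_{(n-1)}|_0^{l}-q\binom{n-1+l}{l}\le R\le p\binom{n-1+l}{l}.$$
   Context: Here $\|z\|^2=|z_1|^2+\cdots+|z_n|^2$, and for $h=(h_1,\dots,h_k)$, $\|h\|^2=|h_1(z)|^2+\cdots+|h_k(z)|^2$; its rank $R$ is the dimension of the complex vector space spanned by $h_1,\dots,h_k$ (equivalently, the rank of its Hermitian coefficient matrix). A polynomial $M(z,\bar z)\in\mathbb C[z_1,\dots,z_n,\bar z_1,\dots,\bar z_n]$ is Hermitian if it is real-valued, and bihomogeneous of bidegree $(d,d)$ if it is homogeneous of degree $d$ in $z$ and of degree $d$ in $\bar z$. Such an $M$ can be written $M(z,\bar z)=Z_d^H\mathcal M Z_d$ with $Z_d$ the vector of all monomials of degree $d$ in $z$ and $\mathcal M$ a Hermitian matrix. The signature $(p,q)$ of $M$ is the pair (number of positive eigenvalues, number of negative eigenvalues) of $\mathcal M$; equivalently $M=|m_1|^2+\cdots+|m_p|^2-|m_{p+1}|^2-\cdots-|m_{p+q}|^2$ with linearly independent holomorphic polynomials $m_i(z)$. Macaulay representation: for positive integers $A$ and $N$ there exist a unique integer $\delta$ with $1\le\delta\le N$ and unique integers $a_N>a_{N-1}>\cdots>a_\delta>0$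 with $a_j\ge j$ for every $j$ such that $A=\binom{a_N}{N}+\cdots+\binom{a_\delta}{\delta}$. For integers $\sigma,\tau$ define $A_{(N)}|_\sigma^\tau=\binom{a_N+\tau}{N+\sigma}+\cdots+\binom{a_\delta+\tau}{\delta+\sigma}$. *)

theory Defs
  imports
    "HOL-Library.Poly_Mapping"
    "HOL-Library.Product_Plus"
    "Jordan_Normal_Form.Char_Poly"
begin

text \<open>
  Polynomials in the variables \<open>z\<^sub>i\<close>, where \<open>i\<close> ranges over a finite type \<open>'n\<close> of cardinality \<open>n\<close>,
  are finitely supported functions from exponent vectors to complex coefficients.
  A polynomial in \<open>z\<close> and its conjugate is indexed by pairs \<open>(\<alpha>, \<beta>)\<close>, with \<open>\<alpha>\<close> the exponent
  of \<open>z\<close> and \<open>\<beta>\<close> that of the conjugate of \<open>z\<close>. Points of complex \<open>n\<close>-space are functions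
  \<open>'n \<Rightarrow> complex\<close>.
\<close>

type_synonym 'n monom = "'n \<Rightarrow>\<^sub>0 nat"
type_synonym 'n hol_poly = "'n monom \<Rightarrow>\<^sub>0 complex"
type_synonym 'n mixed_poly = "('n monom \<times> 'n monom) \<Rightarrow>\<^sub>0 complex"

definition mdeg :: "'n::finite monom \<Rightarrow> nat" where
  "mdeg \<alpha> = (\<Sum>i\<in>UNIV. Poly_Mapping.lookup \<alpha> i)"

definition eval_monom :: "'n::finite monom \<Rightarrow> ('n \<Rightarrow> complex) \<Rightarrow> complex" where
  "eval_monom \<alpha> z = (\<Prod>i\<in>UNIV. z i ^ Poly_Mapping.lookup \<alpha> i)"

definition eval_hol :: "'n::finite hol_poly \<Rightarrow> ('n \<Rightarrow> complex) \<Rightarrow> complex" where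
  "eval_hol f z = (\<Sum>\<alpha>\<in>Poly_Mapping.keys f. Poly_Mapping.lookup f \<alpha> * eval_monom \<alpha> z)"

definition eval_mixed :: "'n::finite mixed_poly \<Rightarrow> ('n \<Rightarrow> complex) \<Rightarrow> complex" where
  "eval_mixed M z = (\<Sum>(\<alpha>, \<beta>)\<in>Poly_Mapping.keys M.
     Poly_Mapping.lookup M (\<alpha>, \<beta>) * eval_monom \<alpha> z * cnj (eval_monom \<beta> z))"

definition hermitian_poly :: "'n::finite mixed_poly \<Rightarrow> bool" where
  "hermitian_poly M \<longleftrightarrow> (\<forall>z. eval_mixed M z \<in> \<real>)"

definition bihomogeneous :: "nat \<Rightarrow> 'n::finite mixed_poly \<Rightarrow> bool" where
  "bihomogeneous d M \<longleftrightarrow> (\<forall>(\<alpha>, \<beta>)\<in>Poly_Mapping.keys M. mdeg \<alpha> = d \<and> mdeg \<beta> = d)"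

definition sqnorm_vec :: "('n::finite \<Rightarrow> complex) \<Rightarrow> real" where
  "sqnorm_vec z = (\<Sum>i\<in>UNIV. (cmod (z i))\<^sup>2)"

definition sqnorm_map :: "'n::finite hol_poly list \<Rightarrow> ('n \<Rightarrow> complex) \<Rightarrow> real" where
  "sqnorm_map h z = (\<Sum>j<length h. (cmod (eval_hol (h ! j) z))\<^sup>2)"

definition hol_scale :: "complex \<Rightarrow> 'n hol_poly \<Rightarrow> 'n hol_poly" where
  "hol_scale c f = Poly_Mapping.map ((*) c) f"

lemma lookup_hol_scale [simp]:
  "Poly_Mapping.lookup (hol_scale c f) \<alpha> = c * Poly_Mapping.lookup f \<alpha>"
  by (simp add: hol_scale_def Poly_Mapping.map.rep_eq when_def)

interpretation hol: vector_space hol_scale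
  by unfold_locales (rule poly_mapping_eqI, simp add: lookup_add algebra_simps)+

definition hol_rank :: "'n::finite hol_poly list \<Rightarrow> nat" where
  "hol_rank h = hol.dim (hol.span (set h))"

lemma finite_monoms_of_degree: "finite {\<alpha> :: 'n::finite monom. mdeg \<alpha> = d}"
proof -
  let ?S = "{\<alpha> :: 'n monom. mdeg \<alpha> = d}"
  have "Poly_Mapping.lookup \<alpha> i \<le> d" if "\<alpha> \<in> ?S" for \<alpha> i
    using that member_le_sum[of i UNIV "Poly_Mapping.lookup \<alpha>"] by (auto simp: mdeg_def)
  then have "Poly_Mapping.lookup ` ?S \<subseteq> Pi\<^sub>E UNIV (\<lambda>_. {..d})"
    by (intro image_subsetI PiE_I) simp_all
  then have "finite (Poly_Mapping.lookup ` ?S)"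
    by (rule finite_subset) (simp add: finite_PiE)
  then show ?thesis
    by (rule finite_imageD) (rule inj_onI, simp)
qed

text \<open>
  An arbitrary ordering of the monomials of degree \<open>d\<close>; a different ordering conjugates the
  coefficient matrix below by a permutation matrix and so does not affect the signature.
\<close>

definition monom_list :: "nat \<Rightarrow> 'n::finite monom list" where
  "monom_list d = (SOME ms. distinct ms \<and> set ms = {\<alpha>. mdeg \<alpha> = d})"

lemma monom_list:
  "distinct (monom_list d :: 'n::finite monom list)"
  "set (monom_list d :: 'n::finite monom list) = {\<alpha>. mdeg \<alpha> = d}"
proof -
  have "\<exists>ms :: 'n monom list. distinct ms \<and> set ms = {\<alpha>. mdeg \<alpha> = d}"
    using finite_distinct_list[OF finite_monoms_of_degree] by blast
  from someI_ex[OF this]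
  show "distinct (monom_list d :: 'n monom list)"
    and "set (monom_list d :: 'n monom list) = {\<alpha>. mdeg \<alpha> = d}"
    by (simp_all add: monom_list_def)
qed

text \<open>
  The matrix \<open>A\<close> with \<open>M = Z\<^sup>H A Z\<close>, where \<open>Z\<close> is the vector of degree-\<open>d\<close> monomials: rows
  belong to conjugated monomials and columns to holomorphic ones.
\<close>

definition coeff_mat :: "nat \<Rightarrow> 'n::finite mixed_poly \<Rightarrow> complex mat" where
  "coeff_mat d M =
     (let ms = monom_list d in
      mat (length ms) (length ms) (\<lambda>(i, j). Poly_Mapping.lookup M (ms ! j, ms ! i)))"

text \<open>Eigenvalues are counted with their multiplicity in the characteristic polynomial.\<close>

definition num_pos_eigenvalues :: "complex mat \<Rightarrow> nat" where
  "num_pos_eigenvalues A =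
     (\<Sum>r | (r::real) > 0 \<and> eigenvalue A (of_real r). order (of_real r) (char_poly A))"

definition num_neg_eigenvalues :: "complex mat \<Rightarrow> nat" where
  "num_neg_eigenvalues A =
     (\<Sum>r | (r::real) < 0 \<and> eigenvalue A (of_real r). order (of_real r) (char_poly A))"

definition signature :: "nat \<Rightarrow> 'n::finite mixed_poly \<Rightarrow> nat \<times> nat" where
  "signature d M = (num_pos_eigenvalues (coeff_mat d M), num_neg_eigenvalues (coeff_mat d M))"

definition macaulay_rep :: "nat \<Rightarrow> nat \<Rightarrow> nat \<Rightarrow> (nat \<Rightarrow> nat) \<Rightarrow> bool" where
  "macaulay_rep A N \<delta> a \<longleftrightarrow>
     1 \<le> \<delta> \<and> \<delta> \<le> N \<and>
     strict_mono_on {\<delta>..N} a \<and> 0 < a \<delta> \<and> (\<forall>j\<in>{\<delta>..N}. j \<le> a j) \<and>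
     A = (\<Sum>j=\<delta>..N. a j choose j)"

text \<open>The binomial coefficient of integers is \<open>0\<close> unless \<open>0 \<le> k \<le> m\<close>.\<close>

definition int_binom :: "int \<Rightarrow> int \<Rightarrow> nat" where
  "int_binom m k = (if 0 \<le> k \<and> k \<le> m then nat m choose nat k else 0)"

text \<open>
  For positive \<open>A\<close> and \<open>N\<close> the Macaulay representation exists, and \<open>\<delta>\<close> and the restriction of
  \<open>a\<close> to \<open>{\<delta>..N}\<close> are unique, so the choice below does not affect the value.
\<close>

definition macaulay_shift :: "nat \<Rightarrow> nat \<Rightarrow> int \<Rightarrow> int \<Rightarrow> nat" where
  "macaulay_shift A N \<sigma> \<tau> =
     (let (\<delta>, a) = (SOME (\<delta>, a). macaulay_rep A N \<delta> a)
      in \<Sum>j=\<delta>..N. int_binom (int (a j) + \<tau>) (int j + \<sigma>))"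

end

theory Submission
  imports Defs "Jordan_Normal_Form.Schur_Decomposition"
begin

text \<open>
  Diagonalising the coefficient matrix gives \<open>M = \<Sum>\<^bsub>P\<^esub> |m\<^sub>k|\<^sup>2 - \<Sum>\<^bsub>Q\<^esub> |m\<^sub>k|\<^sup>2\<close>
  with independent \<open>m\<^sub>k\<close>, \<open>card P = p\<close> and \<open>card Q = q\<close>. Expanding \<open>\<parallel>z\<parallel>\<^sup>2\<^sup>l\<close> over words \<open>w\<close> of length
  \<open>l\<close> in the variables turns the hypothesis into
  \<open>\<parallel>h\<parallel>\<^sup>2 + \<Sum>\<^bsub>k \<in> Q, w\<^esub> |z\<^sub>w m\<^sub>k|\<^sup>2 = \<Sum>\<^bsub>k \<in> P, w\<^esub> |z\<^sub>w m\<^sub>k|\<^sup>2\<close>. By polarization both sides span the same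
  space, which gives the upper bound, and shows that the products of all \<open>m\<^sub>k\<close> with the monomials of degree
  \<open>l\<close> span a space of dimension at most \<open>R + q * binomial (n - 1 + l) l\<close>. Passing to leading
  monomials, the lower bound becomes Macaulay's growth theorem for sets of monomials of equal degree.

  That theorem is proved by induction on the number of variables and on the degree, in the manner of Frankl's
  proof of the Kruskal-Katona theorem. After compression with respect to a variable \<open>x\<close>,
  dividing the multiples of \<open>x\<close> in \<open>B\<close> by \<open>x\<close> gives a set whose shadow lies in
  \<open>B\<close>, so there cannot be too many such multiples; hence many elements of \<open>B\<close> avoid \<open>x\<close>,
  and their shadow in the other variables is disjoint from \<open>x B\<close>.
\<close>

section \<open>Macaulay's growth theorem for sets of exponents\<close>

definition inc :: "'v \<Rightarrow> ('v \<Rightarrow> nat) \<Rightarrow> 'v \<Rightarrow> nat" where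
  "inc i u = u(i := Suc (u i))"

text \<open>Reading exponent vectors as monomials, this is the upper shadow of \<open>B\<close>: all
  products of an element of \<open>B\<close> with one variable from \<open>S\<close>.\<close>

definition up :: "'v set \<Rightarrow> ('v \<Rightarrow> nat) set \<Rightarrow> ('v \<Rightarrow> nat) set" where
  "up S B = (\<Union>i\<in>S. inc i ` B)"

text \<open>The vectors live on the whole type and vanish off \<open>S\<close>, so that dropping a
  variable in the induction replaces \<open>S\<close> by \<open>S - {x}\<close> and changes no
  type.\<close>

definition exps :: "'v set \<Rightarrow> nat \<Rightarrow> ('v \<Rightarrow> nat) set" where
  "exps S d = {u. (\<forall>i. i \<notin> S \<longrightarrow> u i = 0) \<and> sum u S = d}"

lemma inc_apply: "inc i u k = (if k = i then Suc (u i) else u k)"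
  by (simp add: inc_def)

lemma inj_inc: "inj (inc i)"
proof (rule injI)
  fix u v :: "'a \<Rightarrow> nat" assume eq: "inc i u = inc i v"
  have "u k = v k" for k
    using fun_cong[OF eq, of k] by (simp add: inc_apply split: if_splits)
  then show "u = v" by auto
qed

lemma sum_inc: "finite S \<Longrightarrow> i \<in> S \<Longrightarrow> sum (inc i u) S = Suc (sum u S)"
  by (simp add: inc_def sum.remove)

lemma inc_exps: "finite S \<Longrightarrow> i \<in> S \<Longrightarrow> u \<in> exps S d \<Longrightarrow> inc i u \<in> exps S (Suc d)"
  unfolding exps_def by (simp add: sum_inc) (auto simp: inc_apply)

lemma up_exps: "finite S \<Longrightarrow> B \<subseteq> exps S d \<Longrightarrow> up S B \<subseteq> exps S (Suc d)"
  by (auto simp: up_def intro!: inc_exps)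

lemma finite_up: "finite S \<Longrightarrow> finite B \<Longrightarrow> finite (up S B)"
  by (simp add: up_def)

lemma up_mono: "B \<subseteq> C \<Longrightarrow> up S B \<subseteq> up S C"
  by (auto simp: up_def)

lemma inc_in_up: "i \<in> S \<Longrightarrow> u \<in> B \<Longrightarrow> inc i u \<in> up S B"
  by (auto simp: up_def)

text \<open>Take \<open>u\<close> with the largest exponent of \<open>x\<close>. A different element
  of \<open>B\<close> can reach the product of \<open>x\<close> and \<open>u\<close> only by having
  a larger exponent of \<open>x\<close>, so this product leaves the shadow together with
  \<open>u\<close>. The growth theorem uses this to turn one spare element into one spare shadow
  element.\<close>

lemma ex_card_up_remove_less:
  assumes S: "finite S" "x \<in> S" and B: "finite B" "B \<noteq> {}"
  shows "\<exists>u\<in>B. card (up S (B - {u})) < card (up S B)"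
proof -
  let ?m = "Max ((\<lambda>u. u x) ` B)"
  have "?m \<in> (\<lambda>u. u x) ` B" using B by (intro Max_in) auto
  then obtain u where u: "u \<in> B" "u x = ?m" by auto
  have le: "v x \<le> u x" if "v \<in> B" for v using B that u by auto
  have "inc x u \<notin> up S (B - {u})"
  proof
    assume "inc x u \<in> up S (B - {u})"
    then obtain i v where iv: "v \<in> B" "v \<noteq> u" "inc x u = inc i v" by (auto simp: up_def)
    have "Suc (u x) = inc i v x" using iv(3) by (metis inc_apply)
    then have "i = x" using le[OF iv(1)] by (auto simp: inc_apply split: if_splits)
    then show False using iv inj_inc by (metis injD)
  qed
  then have "up S (B - {u}) \<subset> up S B"
    using up_mono[of "B - {u}" B S] inc_in_up[OF S(2) u(1)] by auto
  then show ?thesis using u(1) psubset_card_mono[OF finite_up[OF S(1) B(1)]] by blast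
qed

subsection \<open>Compression of two variables\<close>

text \<open>This substitutes the variable \<open>i\<close> for \<open>x\<close>. Two monomials with
  the same image differ by exchanging factors \<open>x\<close> and \<open>i\<close>, and within such
  a fibre a monomial is determined by its exponent of \<open>x\<close>.\<close>

definition merge :: "'v \<Rightarrow> 'v \<Rightarrow> ('v \<Rightarrow> nat) \<Rightarrow> 'v \<Rightarrow> nat" where
  "merge x i u = u(i := u i + u x, x := 0)"

text \<open>Along each fibre of \<open>merge x i\<close>, the set is replaced by one of the same size with the least exponents of \<open>x\<close>.\<close>

definition compress :: "'v \<Rightarrow> 'v \<Rightarrow> ('v \<Rightarrow> nat) set \<Rightarrow> ('v \<Rightarrow> nat) set" where
  "compress x i B = {u. u x < card {v \<in> B. merge x i v = merge x i u}}"

lemma merge_inc: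
  assumes "x \<noteq> i"
  shows "merge x i (inc k u) = inc (if k = x then i else k) (merge x i u)"
  using assms by (auto simp: merge_def inc_def fun_eq_iff)

lemma merge_eqD:
  assumes "merge x i u = merge x i v" "u x = v x" "x \<noteq> i"
  shows "u = v"
proof
  fix k
  show "u k = v k"
    using fun_cong[OF assms(1), of k] fun_cong[OF assms(1), of i] assms(2,3)
    by (auto simp: merge_def split: if_splits)
qed

lemma merge_fiber:
  assumes "x \<noteq> i" "merge x i u = w"
  shows "u x \<le> w i" "w x = 0"
  using assms by (auto simp: merge_def)

lemma merge_fiber_of:
  assumes "x \<noteq> i" "t \<le> w i" "w x = 0"
  shows "merge x i (w(i := w i - t, x := t)) = w"
  using assms by (auto simp: merge_def)

lemma inj_on_fiber: "x \<noteq> i \<Longrightarrow> inj_on (\<lambda>u. u x) {v \<in> B. merge x i v = w}"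
  by (rule inj_onI) (auto dest!: merge_eqD[of x i, rotated])

lemma card_fiber_le:
  assumes "x \<noteq> i" "merge x i u = w"
  shows "card {v \<in> B. merge x i v = w} \<le> Suc (w i)"
proof -
  have "card {v \<in> B. merge x i v = w} = card ((\<lambda>u. u x) ` {v \<in> B. merge x i v = w})"
    by (rule card_image[symmetric, OF inj_on_fiber[OF assms(1)]])
  also have "\<dots> \<le> card {..w i}"
    by (rule card_mono) (use merge_fiber(1)[OF assms(1)] in auto)
  finally show ?thesis by simp
qed

text \<open>The exponents of \<open>x\<close> on the fibre over \<open>w\<close> lie in
  \<open>{..w i}\<close>, so each \<open>t\<close> below the size of the original fibre is at most
  \<open>w i\<close>. It is therefore realised by the monomial obtained from \<open>w\<close> by
  exchanging \<open>t\<close> factors \<open>i\<close> for \<open>x\<close>.\<close>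

lemma compress_fiber_bij:
  assumes "x \<noteq> i"
  shows "bij_betw (\<lambda>u. u x) {v \<in> compress x i B. merge x i v = w}
           {..<card {v \<in> B. merge x i v = w}}"
  unfolding bij_betw_def
proof
  show "inj_on (\<lambda>u. u x) {v \<in> compress x i B. merge x i v = w}"
    by (rule inj_on_fiber[OF assms])
  show "(\<lambda>u. u x) ` {v \<in> compress x i B. merge x i v = w} = {..<card {v \<in> B. merge x i v = w}}"
  proof (rule subset_antisym; rule subsetI)
    fix t assume "t \<in> (\<lambda>u. u x) ` {v \<in> compress x i B. merge x i v = w}"
    then show "t \<in> {..<card {v \<in> B. merge x i v = w}}" by (auto simp: compress_def)
  next
    fix t assume t: "t \<in> {..<card {v \<in> B. merge x i v = w}}"
    then have "{v \<in> B. merge x i v = w} \<noteq> {}" by (intro notI) simp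
    then obtain v where v: "v \<in> B" "merge x i v = w" by auto
    let ?u = "w(i := w i - t, x := t)"
    have "t \<le> w i" using card_fiber_le[OF assms v(2), of B] t by auto
    then have m: "merge x i ?u = w" using merge_fiber_of[OF assms] merge_fiber(2)[OF assms v(2)] by auto
    then have "?u \<in> {v \<in> compress x i B. merge x i v = w}" using t by (simp add: compress_def)
    then have "?u x \<in> (\<lambda>u. u x) ` {v \<in> compress x i B. merge x i v = w}" by (rule imageI)
    then show "t \<in> (\<lambda>u. u x) ` {v \<in> compress x i B. merge x i v = w}" by simp
  qed
qed

lemma compress_nonempty_fiber:
  assumes "u \<in> compress x i B"
  obtains v where "v \<in> B" "merge x i v = merge x i u"
proof -
  have "{v \<in> B. merge x i v = merge x i u} \<noteq> {}"
    using assms by (intro notI) (simp add: compress_def)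
  then show ?thesis using that by blast
qed

lemma merge_image_compress: "x \<noteq> i \<Longrightarrow> merge x i ` compress x i B \<subseteq> merge x i ` B"
  by (auto elim!: compress_nonempty_fiber) (metis image_eqI)

lemma finite_compress:
  assumes "x \<noteq> i" "finite B"
  shows "finite (compress x i B)"
proof -
  have "compress x i B \<subseteq> (\<Union>w\<in>merge x i ` B. {v \<in> compress x i B. merge x i v = w})"
    using merge_image_compress[OF assms(1), of B] by auto
  moreover have "finite {v \<in> compress x i B. merge x i v = w}" for w
    using bij_betw_finite[OF compress_fiber_bij[OF assms(1), of B w]] by simp
  ultimately show ?thesis using assms(2) by (meson finite_UN_I finite_imageI finite_subset)
qed

lemma sum_over_fibers:
  assumes "finite B" "merge x i ` B \<subseteq> W" "finite W"
  shows "sum f B = (\<Sum>w\<in>W. sum f {v \<in> B. merge x i v = w})"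
  using sum.group[OF assms(1,3,2), of f] by simp

lemma card_compress:
  assumes "x \<noteq> i" "finite B"
  shows "card (compress x i B) = card B"
proof -
  let ?W = "merge x i ` B"
  have "card (compress x i B) = (\<Sum>w\<in>?W. card {v \<in> compress x i B. merge x i v = w})"
    using sum_over_fibers[OF finite_compress[OF assms] merge_image_compress[OF assms(1)], of "\<lambda>_. 1::nat"]
      assms(2) by simp
  also have "\<dots> = (\<Sum>w\<in>?W. card {v \<in> B. merge x i v = w})"
    using bij_betw_same_card[OF compress_fiber_bij[OF assms(1)]] by simp
  also have "\<dots> = card B"
    using sum_over_fibers[OF assms(2) subset_refl, of x i "\<lambda>_. 1::nat"] assms(2) by simp
  finally show ?thesis .
qed

lemma compress_exps:
  assumes "x \<noteq> i" "finite S" "x \<in> S" "i \<in> S" "B \<subseteq> exps S d"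
  shows "compress x i B \<subseteq> exps S d"
proof
  fix u assume "u \<in> compress x i B"
  then obtain v where v: "v \<in> B" "merge x i v = merge x i u" by (rule compress_nonempty_fiber)
  have eq: "v k = u k" if "k \<noteq> x" "k \<noteq> i" for k
    using fun_cong[OF v(2), of k] that by (simp add: merge_def)
  have eqi: "v i + v x = u i + u x"
    using fun_cong[OF v(2), of i] assms(1) by (simp add: merge_def)
  have rest: "sum v (S - {x} - {i}) = sum u (S - {x} - {i})"
    by (rule sum.cong) (use eq in auto)
  have split: "sum f S = f i + f x + sum f (S - {x} - {i})" for f :: "'a \<Rightarrow> nat"
    using assms by (simp add: sum.remove[of S x] sum.remove[of "S - {x}" i])
  have "sum v S = sum u S"
    unfolding split eqi rest ..
  moreover have "v \<in> exps S d" using v assms by auto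
  ultimately show "u \<in> exps S d"
    using eq assms(3,4) by (auto simp: exps_def) metis
qed

text \<open>Membership in a compressed set is a count on one fibre. For \<open>k\<close> other than
  \<open>x\<close> the exponent of \<open>x\<close> stays, and multiplication by \<open>k\<close>
  injects the old fibre into the new one. For \<open>k = x\<close> one more element is required: the
  new fibre contains the old one multiplied by \<open>i\<close>, and also \<open>x\<close> times the
  element with the largest exponent of \<open>x\<close>. Hence the shadow of the compression lies in
  the compression of the shadow.\<close>

lemma inc_compress:
  assumes ix: "x \<noteq> i" and S: "finite S" "x \<in> S" "i \<in> S" "k \<in> S" and B: "finite B"
    and u: "u \<in> compress x i B"
  shows "inc k u \<in> compress x i (up S B)"
proof -
  let ?F = "{v \<in> B. merge x i v = merge x i u}"
  let ?G = "{v \<in> up S B. merge x i v = merge x i (inc k u)}"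
  have fG: "finite ?G" using finite_up[OF S(1) B] by simp
  have lt: "u x < card ?F" using u by (simp add: compress_def)
  show ?thesis
  proof (cases "k = x")
    case False
    have "inc k ` ?F \<subseteq> ?G"
      using S(4) ix by (auto simp: merge_inc inc_in_up)
    then have "card (inc k ` ?F) \<le> card ?G" by (rule card_mono[OF fG])
    moreover have "card (inc k ` ?F) = card ?F"
      by (rule card_image[OF inj_on_subset[OF inj_inc]]) simp
    ultimately have "card ?F \<le> card ?G" by simp
    then show ?thesis using lt False by (simp add: compress_def inc_apply)
  next
    case True
    have fF: "finite ?F" using B by simp
    have neF: "?F \<noteq> {}" using lt by (intro notI) simp
    let ?m = "Max ((\<lambda>v. v x) ` ?F)"
    have "?m \<in> (\<lambda>v. v x) ` ?F" using fF neF by (intro Max_in) auto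
    then obtain v where v: "v \<in> ?F" "v x = ?m" by auto
    have le: "v' x \<le> v x" if "v' \<in> ?F" for v' using fF that v(2) by auto
    have nin: "inc x v \<notin> inc i ` ?F"
    proof
      assume "inc x v \<in> inc i ` ?F"
      then obtain v' where "v' \<in> ?F" "inc x v = inc i v'" by auto
      moreover from this(2) have "Suc (v x) = v' x" using ix by (metis inc_apply)
      ultimately show False using le by fastforce
    qed
    have "insert (inc x v) (inc i ` ?F) \<subseteq> ?G"
      using S v(1) ix True by (auto simp: merge_inc inc_in_up)
    then have "card (insert (inc x v) (inc i ` ?F)) \<le> card ?G" by (rule card_mono[OF fG])
    moreover have "card (inc i ` ?F) = card ?F"
      by (rule card_image[OF inj_on_subset[OF inj_inc]]) simp
    ultimately have "Suc (card ?F) \<le> card ?G" using nin fF by simp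
    then show ?thesis using lt True by (simp add: compress_def inc_apply)
  qed
qed

lemma card_up_compress:
  assumes "x \<noteq> i" "finite S" "x \<in> S" "i \<in> S" "finite B"
  shows "card (up S (compress x i B)) \<le> card (up S B)"
proof -
  have "up S (compress x i B) \<subseteq> compress x i (up S B)"
    using inc_compress[OF assms(1,2,3,4) _ assms(5)] by (auto simp: up_def[of S "compress x i B"])
  then show ?thesis
    using card_mono[OF finite_compress[OF assms(1) finite_up[OF assms(2,5)]]]
      card_compress[OF assms(1) finite_up[OF assms(2,5)]] by metis
qed

section \<open>Repeated compression and its termination\<close>

text \<open>\<open>T\<close> and the initial segment of the same size have equally many elements
  outside their intersection; those of \<open>T\<close> are at least \<open>card T\<close>, those of
  the segment are below it.\<close>

lemma sum_initial_less:
  fixes T :: "nat set"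
  assumes "finite T"
  shows "\<Sum>{..<card T} \<le> \<Sum>T" "T \<noteq> {..<card T} \<Longrightarrow> \<Sum>{..<card T} < \<Sum>T"
proof -
  let ?c = "card T"
  let ?D = "T - {..<?c}" and ?E = "{..<?c} - T"
  have card: "card ?D = card ?E"
    using card_Int_Diff[OF assms, of "{..<?c}"] card_Int_Diff[OF finite_lessThan, of ?c T]
    by (simp add: Int_commute)
  have T: "\<Sum>T = \<Sum>(T \<inter> {..<?c}) + \<Sum>?D"
    using sum.Int_Diff[OF assms, of "\<lambda>x. x"] by simp
  have I: "\<Sum>{..<?c} = \<Sum>(T \<inter> {..<?c}) + \<Sum>?E"
    using sum.Int_Diff[OF finite_lessThan, of "\<lambda>x. x" ?c T] by (simp add: Int_commute)
  have D: "?c * card ?D \<le> \<Sum>?D"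
    using sum_bounded_below[of ?D ?c "\<lambda>x. x"] by (auto simp: mult.commute)
  have E: "\<Sum>?E \<le> ?c * card ?E"
    using sum_bounded_above[of ?E "\<lambda>x. x" ?c] by (auto simp: mult.commute)
  show "\<Sum>{..<?c} \<le> \<Sum>T" using T I D E card by simp
  assume ne: "T \<noteq> {..<?c}"
  have "?E \<noteq> {}"
  proof
    assume "?E = {}"
    then have "{..<?c} \<subseteq> T" by auto
    then show False using ne card_subset_eq[OF assms, of "{..<?c}"] by simp
  qed
  then have "\<Sum>?E < ?c * card ?E"
    using sum_strict_mono[of ?E "\<lambda>x. x" "\<lambda>_. ?c"] by (simp add: mult.commute)
  then show "\<Sum>{..<?c} < \<Sum>T" using T I D card by simp
qed

text \<open>The fibre of \<open>u\<close> contains the exponent \<open>u x\<close> of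
  \<open>x\<close> but misses \<open>u x - 1\<close>, so its exponents are not an initial segment
  and compression lowers their sum strictly. On the other fibres the sum cannot grow.\<close>

lemma weight_compress:
  assumes ix: "x \<noteq> i" and B: "finite B" and u: "u \<in> B" "0 < u x" "u(x := u x - 1, i := Suc (u i)) \<notin> B"
  shows "(\<Sum>v\<in>compress x i B. v x) < (\<Sum>v\<in>B. v x)"
proof -
  let ?W = "merge x i ` B"
  let ?F = "\<lambda>w. {v \<in> B. merge x i v = w}"
  let ?T = "\<lambda>w. (\<lambda>v. v x) ` ?F w"
  have fT: "finite (?T w)" for w using B by simp
  have cT: "card (?T w) = card (?F w)" for w by (rule card_image[OF inj_on_fiber[OF ix]])
  have TB: "(\<Sum>v\<in>?F w. v x) = \<Sum>(?T w)" for w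
    using sum.reindex[OF inj_on_fiber[OF ix], of "\<lambda>x. x" B w] by simp
  have TC: "(\<Sum>v\<in>{v \<in> compress x i B. merge x i v = w}. v x) = \<Sum>{..<card (?T w)}" for w
    using sum.reindex_bij_betw[OF compress_fiber_bij[OF ix], of "\<lambda>x. x" B w] by (simp add: cT)
  have C: "(\<Sum>v\<in>compress x i B. v x) = (\<Sum>w\<in>?W. \<Sum>{..<card (?T w)})"
    using sum_over_fibers[OF finite_compress[OF ix B] merge_image_compress[OF ix], of "\<lambda>v. v x"] B TC by simp
  have D: "(\<Sum>v\<in>B. v x) = (\<Sum>w\<in>?W. \<Sum>(?T w))"
    using sum_over_fibers[OF B subset_refl, of x i "\<lambda>v. v x"] B TB by simp
  let ?w = "merge x i u" and ?u = "u(x := u x - 1, i := Suc (u i))"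
  have mu: "merge x i ?u = ?w" using ix u(2) by (auto simp: merge_def fun_eq_iff)
  have "u x - 1 \<notin> ?T ?w"
  proof
    assume "u x - 1 \<in> ?T ?w"
    then obtain v where v: "v \<in> B" "merge x i v = ?w" "v x = u x - 1" by auto
    then have "v = ?u" using merge_eqD[of x i v ?u] mu ix by simp
    then show False using v u by simp
  qed
  moreover have "u x \<in> ?T ?w" using u by auto
  ultimately have ne: "?T ?w \<noteq> {..<card (?T ?w)}"
    by (metis (lifting) lessThan_iff less_imp_diff_less)
  have "\<Sum>{..<card (?T ?w)} < \<Sum>(?T ?w)" by (rule sum_initial_less(2)[OF fT ne])
  then show ?thesis unfolding C D
    using B u(1) sum_initial_less(1)[OF fT] by (intro sum_strict_mono_ex1) auto
qed

text \<open>Compress as long as some exchange of one factor \<open>x\<close> for another variable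
  leaves the set. The total exponent of \<open>x\<close> drops each time, while the size is kept and
  the shadow does not grow.\<close>

lemma ex_compressed:
  assumes "finite S" "x \<in> S" "finite B" "B \<subseteq> exps S d"
  shows "\<exists>C \<subseteq> exps S d. finite C \<and> card C = card B \<and> card (up S C) \<le> card (up S B) \<and>
    (\<forall>u\<in>C. \<forall>i\<in>S - {x}. 0 < u x \<longrightarrow> u(x := u x - 1, i := Suc (u i)) \<in> C)"
  using assms(3,4)
proof (induction "\<Sum>v\<in>B. v x" arbitrary: B rule: less_induct)
  case less
  show ?case
  proof (cases "\<forall>u\<in>B. \<forall>i\<in>S - {x}. 0 < u x \<longrightarrow> u(x := u x - 1, i := Suc (u i)) \<in> B")
    case True
    then show ?thesis using less.prems by blast
  next
    case False
    then obtain u i where u: "u \<in> B" "i \<in> S" "x \<noteq> i" "0 < u x" "u(x := u x - 1, i := Suc (u i)) \<notin> B"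
      by auto
    let ?C = "compress x i B"
    from less.hyps[OF weight_compress[OF u(3) less.prems(1) u(1,4,5)]
        finite_compress[OF u(3) less.prems(1)] compress_exps[OF u(3) assms(1,2) u(2) less.prems(2)]]
    obtain C where C: "C \<subseteq> exps S d" "finite C" "card C = card ?C" "card (up S C) \<le> card (up S ?C)"
      "\<forall>u\<in>C. \<forall>i\<in>S - {x}. 0 < u x \<longrightarrow> u(x := u x - 1, i := Suc (u i)) \<in> C"
      by (elim exE conjE)
    have "card C = card B" "card (up S C) \<le> card (up S B)"
      using C(3,4) card_compress[OF u(3) less.prems(1)] card_up_compress[OF u(3) assms(1,2) u(2) less.prems(1)]
      by simp_all
    then show ?thesis using C(1,2,5) by (intro exI[of _ C] conjI)
  qed
qed


section \<open>The growth theorem\<close>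

text \<open>The products of \<open>x\<close> with elements of \<open>B\<close> are divisible by
  \<open>x\<close>. The elements free of \<open>x\<close>, multiplied by the other variables, stay
  free of \<open>x\<close>, so the two parts of the shadow are disjoint.\<close>

lemma up_hyperplane:
  assumes S: "finite S" "x \<in> S" and B: "finite B"
  shows "card B + card (up (S - {x}) {u \<in> B. u x = 0}) \<le> card (up S B)"
proof -
  let ?U = "up (S - {x}) {u \<in> B. u x = 0}"
  have "inc x ` B \<inter> ?U = {}" by (auto simp: up_def inc_def dest!: fun_cong[where x = x] split: if_splits)
  then have "card (inc x ` B \<union> ?U) = card (inc x ` B) + card ?U"
    using S B by (intro card_Un_disjoint) (auto intro!: finite_up)
  also have "card (inc x ` B) = card B"
    by (rule card_image[OF inj_on_subset[OF inj_inc]]) simp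
  finally show ?thesis
    using card_mono[OF finite_up[OF S(1) B], of "inc x ` B \<union> ?U"] S(2)
    by (auto simp: up_def)
qed

lemma strict_mono_on_nat_add_diff_le:
  fixes a :: "nat \<Rightarrow> nat"
  assumes "strict_mono_on {m..n} a" "m \<le> j" "j \<le> k" "k \<le> n"
  shows "a j + (k - j) \<le> a k"
  using assms(3,4)
proof (induction k rule: dec_induct)
  case (step k)
  then have "a k < a (Suc k)"
    using assms(2) by (intro strict_mono_onD[OF assms(1)]) auto
  then show ?case using step by simp
qed simp

lemma sum_atLeastAtMost_split:
  fixes f :: "nat \<Rightarrow> nat"
  assumes "m \<le> k" "k \<le> n"
  shows "sum f {m..n} = sum f {m..k} + sum f {Suc k..n}"
proof -
  have "{m..n} = {m..k} \<union> {Suc k..n}" using assms by auto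
  then show ?thesis by (simp add: sum.union_disjoint)
qed

text \<open>The size of \<open>B\<close> is only bounded below, and the sum may be empty, so that
  the statement can be applied to truncated and shifted sums. The outer induction removes a
  variable, the inner one lowers the degree. By Pascal's rule the goal is \<open>?A\<close> plus the
  sum of \<open>a j choose (j - 1)\<close>, matching the two disjoint parts of the shadow in
  \<open>up_hyperplane\<close>.\<close>

lemma card_up_ge_macaulay:
  assumes "finite S" "card S = Suc N" "finite B" "B \<subseteq> exps S d"
    and "1 \<le> \<delta>" "strict_mono_on {\<delta>..N} a" "\<forall>j\<in>{\<delta>..N}. j \<le> a j"
    and "(\<Sum>j=\<delta>..N. a j choose j) \<le> card B"
  shows "(\<Sum>j=\<delta>..N. Suc (a j) choose j) \<le> card (up S B)"
  using assms
proof (induction N arbitrary: S d B \<delta> a)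
  case 0
  then show ?case by simp
next
  case (Suc N)
  note IH_N = Suc.IH
  show ?case using Suc.prems
  proof (induction d arbitrary: B \<delta> a rule: less_induct)
    case (less d)
    note S = less.prems(1,2) and \<delta> = less.prems(5) and mono = less.prems(6) and ge = less.prems(7)
    note sum.cl_ivl_Suc [simp del]
    let ?A = "\<Sum>j=\<delta>..Suc N. a j choose j"
    let ?c = "\<Sum>j=\<delta>..Suc N. a j - 1 choose (j - 1)"
    let ?e = "\<Sum>j=\<delta>..Suc N. a j - 1 choose j"
    have pascal: "m choose j = (m - 1 choose (j - 1)) + (m - 1 choose j)"
      "Suc m choose j = (m choose (j - 1)) + (m choose j)" if "1 \<le> j" "j \<le> m" for m j :: nat
      using that by (cases m; cases j; simp)+
    have A_eq: "?A = ?c + ?e"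
      unfolding sum.distrib[symmetric] by (rule sum.cong[OF refl], rule pascal(1)) (use ge \<delta> in auto)
    \<comment> \<open>Cutting down to exactly \<open>?A\<close> elements makes \<open>card D\<close>
      equal to \<open>?A\<close>, and this is the upper bound on \<open>up S ?C\<close> that is
      contradicted below.\<close>
    obtain B' where B': "B' \<subseteq> B" "card B' = ?A" "finite B'"
      using obtain_subset_with_card_n[OF less.prems(8)] less.prems(3) by (metis finite_subset)
    obtain x where x: "x \<in> S" using S(2) by fastforce
    obtain D where D: "D \<subseteq> exps S d" "finite D" "card D = ?A" "card (up S D) \<le> card (up S B')"
      "\<And>u i. u \<in> D \<Longrightarrow> i \<in> S - {x} \<Longrightarrow> 0 < u x \<Longrightarrow> u(x := u x - 1, i := Suc (u i)) \<in> D"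
      using ex_compressed[OF S(1) x B'(3)] B' less.prems(4) by (metis (no_types, lifting) order_trans)
    let ?S = "S - {x}"
    let ?D0 = "{u \<in> D. u x = 0}"
    let ?C = "{u. inc x u \<in> D}"
    have D0: "?D0 \<subseteq> exps ?S d" "finite ?D0"
      using D(1,2) S(1) x by (auto simp: exps_def sum.remove)
    have incC: "inc x ` ?C = {u \<in> D. u x \<noteq> 0}"
    proof (rule subset_antisym; rule subsetI)
      fix u assume u: "u \<in> {u \<in> D. u x \<noteq> 0}"
      then have "u = inc x (u(x := u x - 1))" by (auto simp: inc_def fun_eq_iff)
      then show "u \<in> inc x ` ?C" using u by (metis (no_types, lifting) image_eqI mem_Collect_eq)
    qed (auto simp: inc_def)
    have finC: "finite ?C"
      using finite_vimageI[OF D(2) inj_inc[of x]] by (simp add: vimage_def)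
    have "card ?D0 + card (inc x ` ?C) = card D"
      unfolding incC using D(2) by (subst card_Un_disjoint[symmetric]) (auto intro!: arg_cong[where f = card])
    then have card_split: "card ?D0 + card ?C = ?A"
      using D(3) card_image[OF inj_on_subset[OF inj_inc, of ?C x]] by simp
    \<comment> \<open>If \<open>i\<close> differs from \<open>x\<close>, then \<open>inc i v\<close>
      arises from \<open>inc x v\<close> in \<open>D\<close> by exchanging one factor
      \<open>x\<close> for \<open>i\<close>, and \<open>D\<close> is closed under such
      exchanges.\<close>
    have upC: "up S ?C \<subseteq> D"
    proof
      fix w assume "w \<in> up S ?C"
      then obtain i v where iv: "i \<in> S" "inc x v \<in> D" "w = inc i v" by (auto simp: up_def)
      show "w \<in> D"
      proof (cases "i = x")
        case False
        have "(inc x v)(x := inc x v x - 1, i := Suc (inc x v i)) = inc i v"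
          using False by (auto simp: inc_def)
        then show ?thesis using D(5)[OF iv(2), of i] iv False by (simp add: inc_apply)
      qed (use iv in simp)
    qed
    have card_upC: "card (up S ?C) \<le> ?A"
      using card_mono[OF D(2) upC] D(3) by simp
    \<comment> \<open>Too few elements of \<open>D\<close> free of \<open>x\<close> would leave more
      than \<open>?e\<close> elements in \<open>?C\<close>. The inner induction would then force a
      shadow of \<open>?C\<close> with more than \<open>?A\<close> elements, although it lies in
      \<open>D\<close>.\<close>
    have key: "?c \<le> card ?D0"
    proof (rule ccontr)
      assume "\<not> ?c \<le> card ?D0"
      then have C_gt: "?e < card ?C" using card_split A_eq by linarith
      then have neC: "?C \<noteq> {}" by (intro notI) simp
      have "\<delta> \<le> Suc N" using \<open>\<not> ?c \<le> card ?D0\<close> by (intro leI notI) simp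
      from neC obtain v0 where "inc x v0 \<in> D" by auto
      then have "sum (inc x v0) S = d" using D(1) by (auto simp: exps_def)
      \<comment> \<open>A multiple of \<open>x\<close> in \<open>D\<close> makes the degree
        positive, so \<open>d - 1\<close> is a genuine predecessor.\<close>
      then have d: "d = Suc (d - 1)" using sum_inc[OF S(1) x, of v0] by simp
      have C: "?C \<subseteq> exps S (d - 1)"
      proof
        fix v assume "v \<in> ?C"
        then have "inc x v \<in> exps S d" using D(1) by auto
        moreover have "sum (inc x v) S = Suc (sum v S)" by (rule sum_inc[OF S(1) x])
        moreover have "inc x v i = v i" if "i \<notin> S" for i using that x by (auto simp: inc_apply)
        ultimately show "v \<in> exps S (d - 1)" by (auto simp: exps_def)
      qed
      have IH_d: "(\<Sum>j=\<delta>'..Suc N. Suc (a' j) choose j) \<le> card (up S C')"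
        if "C' \<subseteq> ?C" "1 \<le> \<delta>'" "strict_mono_on {\<delta>'..Suc N} a'" "\<forall>j\<in>{\<delta>'..Suc N}. j \<le> a' j"
          "(\<Sum>j=\<delta>'..Suc N. a' j choose j) \<le> card C'" for C' \<delta>' a'
        using less.IH[of "d - 1" C' \<delta>' a'] d S that finite_subset[OF that(1) finC] C by auto
      show False
      proof (cases "\<forall>j\<in>{\<delta>..Suc N}. a j \<noteq> j")
        case True
        let ?a = "\<lambda>j. a j - 1"
        have ge': "\<forall>j\<in>{\<delta>..Suc N}. j \<le> ?a j"
          using ge True by (auto simp: le_less Suc_le_eq less_Suc_eq_le dest!: bspec)
        have mono': "strict_mono_on {\<delta>..Suc N} ?a"
        proof (rule strict_mono_onI)
          fix r s assume rs: "r \<in> {\<delta>..Suc N}" "s \<in> {\<delta>..Suc N}" "r < s"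
          then have "a r < a s" by (rule strict_mono_onD[OF mono])
          moreover have "1 \<le> a r" using ge rs(1) \<delta> by (metis atLeastAtMost_iff order_trans)
          ultimately show "a r - 1 < a s - 1" by linarith
        qed
        obtain u where u: "u \<in> ?C" "card (up S (?C - {u})) < card (up S ?C)"
          using ex_card_up_remove_less[OF S(1) x finC neC] by blast
        have "card (?C - {u}) = card ?C - 1" using u(1) finC by simp
        then have "?e \<le> card (?C - {u})" using C_gt by linarith
        then have "(\<Sum>j=\<delta>..Suc N. Suc (?a j) choose j) \<le> card (up S (?C - {u}))"
          by (intro IH_d \<delta> mono' ge') auto
        moreover have "(\<Sum>j=\<delta>..Suc N. Suc (?a j) choose j) = ?A"
        proof (rule sum.cong[OF refl])
          fix j assume "j \<in> {\<delta>..Suc N}"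
          then have "Suc (a j - 1) = a j" using ge \<delta> by fastforce
          then show "Suc (a j - 1) choose j = a j choose j" by simp
        qed
        ultimately show False using u(2) card_upC by simp
      next
        case False
        let ?J = "{j \<in> {\<delta>..Suc N}. a j = j}"
        \<comment> \<open>\<open>m\<close> is the last index at which \<open>a j - 1\<close> would
          fall below \<open>j\<close>; beyond it the lowered tops remain admissible.\<close>
        define m where "m = Max ?J"
        have "m \<in> ?J" unfolding m_def using False by (intro Max_in) auto
        then have m: "\<delta> \<le> m" "m \<le> Suc N" "a m = m" by auto
        have m_max: "j \<le> m" if "j \<in> ?J" for j unfolding m_def using that by (intro Max_ge) auto
        \<comment> \<open>A strictly increasing \<open>a\<close> with \<open>j \<le> a j\<close>
          that attains \<open>a m = m\<close> has no room to deviate below \<open>m\<close>.\<close>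
        have low: "a j = j" if "j \<in> {\<delta>..m}" for j
        proof -
          have "j \<in> {\<delta>..Suc N}" using m that by auto
          then have "j \<le> a j" using ge by blast
          moreover have "a j + (m - j) \<le> a m"
            using m that by (intro strict_mono_on_nat_add_diff_le[OF mono]) auto
          ultimately show ?thesis using m that by auto
        qed
        have high: "Suc j \<le> a j" if "j \<in> {Suc m..Suc N}" for j
        proof -
          have "j \<le> a j" "a j \<noteq> j" using ge m_max[of j] that m by auto
          then show ?thesis by simp
        qed
        txt \<open>The terms of \<open>?e\<close> up to \<open>m\<close> vanish, so the extra element of \<open>?C\<close> can be absorbed as the term \<open>binomial m m\<close>.\<close>
        let ?a = "\<lambda>j. if j = m then m else a j - 1"
        have mono': "strict_mono_on {m..Suc N} ?a"
        proof (rule strict_mono_onI)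
          fix r s assume rs: "r \<in> {m..Suc N}" "s \<in> {m..Suc N}" "r < s"
          then have "a r < a s" using m by (intro strict_mono_onD[OF mono]) auto
          then show "?a r < ?a s" using high[of s] rs high[of r] by (cases "r = m") auto
        qed
        have ge': "\<forall>j\<in>{m..Suc N}. j \<le> ?a j" 
        proof
          fix j assume "j \<in> {m..Suc N}" then show "j \<le> ?a j" using high[of j] by (cases "j = m") auto
        qed
        let ?r = "\<lambda>f. sum f {Suc m..Suc N} :: nat"
        have "?e = ?r (\<lambda>j. a j - 1 choose j)"
          using low \<delta> m by (subst sum_atLeastAtMost_split[OF m(1,2)]) simp
        moreover have head: "sum f {m..Suc N} = f m + ?r f" for f :: "nat \<Rightarrow> nat"
          using m by (simp add: sum.atLeast_Suc_atMost)
        have "(\<Sum>j=m..Suc N. ?a j choose j) = 1 + ?r (\<lambda>j. a j - 1 choose j)"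
          by (subst head) (auto intro!: sum.cong)
        ultimately have "(\<Sum>j=m..Suc N. ?a j choose j) \<le> card ?C" using C_gt by linarith
        then have "(\<Sum>j=m..Suc N. Suc (?a j) choose j) \<le> card (up S ?C)"
          using m(1) \<delta> by (intro IH_d mono' ge') auto
        moreover have "(\<Sum>j=m..Suc N. Suc (?a j) choose j) = Suc m + ?r (\<lambda>j. a j choose j)"
        proof -
          have "?r (\<lambda>j. Suc (?a j) choose j) = ?r (\<lambda>j. a j choose j)"
          proof (rule sum.cong[OF refl])
            fix j assume "j \<in> {Suc m..Suc N}"
            then have "Suc (?a j) = a j" using high[of j] by auto
            then show "Suc (?a j) choose j = a j choose j" by simp
          qed
          then show ?thesis by (subst head) (simp add: binomial_Suc_n)
        qed
        \<comment> \<open>Each index from \<open>\<delta>\<close> to \<open>m\<close> contributes 1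
          to \<open>?A\<close>. Because \<open>\<delta>\<close> is at least 1, their number
          \<open>Suc m - \<delta>\<close> is smaller than the contribution \<open>Suc m\<close>
          obtained from the single term at \<open>m\<close>.\<close>
        moreover have "?A = Suc m - \<delta> + ?r (\<lambda>j. a j choose j)"
          using low by (subst sum_atLeastAtMost_split[OF m(1,2)]) simp
        ultimately show False using card_upC \<delta> m(1) by linarith
      qed
    qed
    obtain \<delta>' where \<delta>': "\<delta> = Suc \<delta>'" using \<delta> by (cases \<delta>) auto
    \<comment> \<open>After the index shift, \<open>?c\<close> is the sum of
      \<open>?b j choose j\<close>. The outer hypothesis raises each \<open>?b j\<close> to
      \<open>a (Suc j)\<close>, which yields the required sum of
      \<open>a j choose (j - 1)\<close>.\<close>
    let ?b = "\<lambda>j. a (Suc j) - 1"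
    have S': "finite ?S" "card ?S = Suc N" using S x by auto
    have b_Suc: "Suc (?b j) = a (Suc j)" if "\<delta>' \<le> j" "j \<le> N" for j
    proof -
      have "Suc j \<le> a (Suc j)" using ge that \<delta>' by auto
      then show ?thesis by simp
    qed
    have IH: "(\<Sum>j=e..N. a (Suc j) choose j) \<le> card (up ?S D')"
      if "D' \<subseteq> ?D0" "1 \<le> e" "\<delta>' \<le> e" "(\<Sum>j=e..N. ?b j choose j) \<le> card D'" for D' e
    proof -
      have "strict_mono_on {e..N} ?b"
      proof (rule strict_mono_onI)
        fix r s assume rs: "r \<in> {e..N}" "s \<in> {e..N}" "r < s"
        then have "a (Suc r) < a (Suc s)" using that(3) \<delta>' by (intro strict_mono_onD[OF mono]) auto
        then show "?b r < ?b s" using b_Suc[of r] rs that(3) by auto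
      qed
      moreover have "\<forall>j\<in>{e..N}. j \<le> ?b j"
      proof
        fix j assume "j \<in> {e..N}"
        then have "Suc j \<le> a (Suc j)" using ge \<delta>' that(3) by auto
        then show "j \<le> ?b j" by simp
      qed
      ultimately have "(\<Sum>j=e..N. Suc (?b j) choose j) \<le> card (up ?S D')"
        using IH_N[OF S'] D0 that finite_subset[OF that(1) D0(2)] by (meson order_trans)
      moreover have "(\<Sum>j=e..N. Suc (?b j) choose j) = (\<Sum>j=e..N. a (Suc j) choose j)"
        by (rule sum.cong[OF refl], subst b_Suc) (use that(3) in auto)
      ultimately show ?thesis by simp
    qed
    have up_D0: "(\<Sum>j=\<delta>..Suc N. a j choose (j - 1)) \<le> card (up ?S ?D0)"
    proof (cases "\<delta>' = 0")
      case False
      have "?c = (\<Sum>j=\<delta>'..N. ?b j choose j)"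
        unfolding \<delta>' sum.shift_bounds_cl_Suc_ivl by simp
      then show ?thesis
        using IH[of ?D0 \<delta>'] False key unfolding \<delta>' sum.shift_bounds_cl_Suc_ivl by simp
    next
      \<comment> \<open>The shifted sum would begin at index 0, outside the range of the outer
        hypothesis. Its term there equals 1, so one element of \<open>?D0\<close> is set aside, the
        hypothesis is applied from index 1, and the strict loss in the shadow returns the missing
        1.\<close>
      case True
      have head: "(\<Sum>j=\<delta>..Suc N. f j) = f 1 + (\<Sum>j=1..N. f (Suc j))" for f :: "nat \<Rightarrow> nat"
        using True unfolding \<delta>' by (simp add: sum.atLeast_Suc_atMost sum.shift_bounds_cl_Suc_ivl)
      have c: "?c = 1 + (\<Sum>j=1..N. ?b j choose j)" by (subst head) simp
      then have "?D0 \<noteq> {}" using key by (intro notI) simp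
      moreover have "?S \<noteq> {}" using S'(2) by (intro notI) simp
      then obtain y where "y \<in> ?S" by blast
      ultimately obtain u where u: "u \<in> ?D0" "card (up ?S (?D0 - {u})) < card (up ?S ?D0)"
        using ex_card_up_remove_less[OF S'(1) _ D0(2)] by blast
      have "card (?D0 - {u}) = card ?D0 - 1" using u(1) D0(2) by simp
      then have "(\<Sum>j=1..N. a (Suc j) choose j) \<le> card (up ?S (?D0 - {u}))"
        using key c True by (intro IH) auto
      then show ?thesis using u(2) by (subst head) simp
    qed
    have "(\<Sum>j=\<delta>..Suc N. Suc (a j) choose j) = ?A + (\<Sum>j=\<delta>..Suc N. a j choose (j - 1))"
      unfolding sum.distrib[symmetric] by (rule sum.cong[OF refl]) (use ge \<delta> in \<open>auto simp: pascal(2)\<close>)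
    also have "\<dots> \<le> card D + card (up ?S ?D0)" using up_D0 D(3) by simp
    also have "\<dots> \<le> card (up S D)" by (rule up_hyperplane[OF S(1) x D(2)])
    also have "\<dots> \<le> card (up S B')" by (rule D(4))
    also have "\<dots> \<le> card (up S B)"
      by (rule card_mono[OF finite_up[OF S(1) less.prems(3)] up_mono[OF B'(1)]])
    finally show ?case .
  qed
qed

text \<open>Adding \<open>l\<close> to all tops keeps them strictly increasing and at least
  \<open>j\<close>. The bound for one shadow is therefore the hypothesis for the next.\<close>

lemma card_iterated_up_ge_macaulay:
  assumes "finite S" "card S = Suc N" "finite B" "B \<subseteq> exps S d"
    and "1 \<le> \<delta>" "strict_mono_on {\<delta>..N} a" "\<forall>j\<in>{\<delta>..N}. j \<le> a j"
    and "(\<Sum>j=\<delta>..N. a j choose j) \<le> card B"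
  shows "(\<Sum>j=\<delta>..N. (a j + l) choose j) \<le> card ((up S ^^ l) B)"
proof (induction l)
  case 0
  then show ?case using assms(8) by simp
next
  case (Suc l)
  have fin: "finite ((up S ^^ l) B)" for l
    by (induction l) (use assms(1,3) finite_up in auto)
  have exps: "(up S ^^ l) B \<subseteq> exps S (d + l)" for l
    by (induction l) (use assms(4) up_exps[OF assms(1)] in simp_all)
  have "(\<Sum>j=\<delta>..N. Suc (a j + l) choose j) \<le> card (up S ((up S ^^ l) B))"
    using assms(1,2) fin exps assms(5) _ _ Suc.IH
    by (rule card_up_ge_macaulay)
      (use assms(6,7) in \<open>auto simp: strict_mono_on_def intro: trans_le_add1\<close>)
  then show ?case by simp
qed

section \<open>Existence of Macaulay representations\<close>

lemma binomial_unbounded: "\<exists>k. A < (k choose Suc N)"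
proof (induction A)
  case 0
  have "0 < (Suc N choose Suc N)" by simp
  then show ?case by blast
next
  case (Suc A)
  then obtain k where k: "A < (k choose Suc N)" by blast
  then have "N \<le> k" using not_less_eq_eq by (fastforce simp: binomial_eq_0)
  then have "0 < (k choose N)" by (rule zero_less_binomial)
  then have "Suc A < (Suc k choose Suc N)" using k binomial_Suc_Suc[of k N] by linarith
  then show ?case by blast
qed

text \<open>The greedy algorithm: take the largest \<open>k'\<close> whose binomial coefficient with
  lower index \<open>Suc N\<close> does not exceed \<open>A\<close>. By Pascal's rule the remainder
  is below \<open>k' choose N\<close>, so the tops of its representation are all smaller than
  \<open>k'\<close>.\<close>

lemma ex_macaulay_sum:
  assumes "1 \<le> N" "1 \<le> A"
  shows "\<exists>\<delta> a. 1 \<le> \<delta> \<and> \<delta> \<le> N \<and> strict_mono_on {\<delta>..N} a \<and> (\<forall>j\<in>{\<delta>..N}. j \<le> a j) \<and>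
    A = (\<Sum>j=\<delta>..N. a j choose j)"
  using assms
proof (induction N arbitrary: A rule: nat_induct_at_least)
  case base
  then show ?case by (intro exI[of _ "1::nat"] exI[of _ "\<lambda>_. A"]) (auto simp: strict_mono_on_def)
next
  case (Suc N)
  define k where "k = (LEAST k. A < (k choose Suc N))"
  have k: "A < (k choose Suc N)"
    unfolding k_def using binomial_unbounded by (rule LeastI_ex)
  have "Suc N < k"
  proof (rule ccontr)
    assume "\<not> Suc N < k"
    then have "k choose Suc N \<le> 1" by (cases "k = Suc N") (auto simp: binomial_eq_0)
    then show False using k Suc.prems by linarith
  qed
  then obtain k' where k': "k = Suc k'" "Suc N \<le> k'" by (cases k) auto
  have le: "(k' choose Suc N) \<le> A"
    using not_less_Least[of k' "\<lambda>k. A < (k choose Suc N)"] k'(1) k_def by simp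
  define r where "r = A - (k' choose Suc N)"
  have A: "A = r + (k' choose Suc N)" using le by (simp add: r_def)
  have r: "r < (k' choose N)" using k A k'(1) by simp
  show ?case
  proof (cases "r = 0")
    case True
    then show ?thesis using A k'(2)
      by (intro exI[of _ "Suc N"] exI[of _ "\<lambda>_. k'"]) (auto simp: strict_mono_on_def)
  next
    case False
    then obtain \<delta> b where b: "1 \<le> \<delta>" "\<delta> \<le> N" "strict_mono_on {\<delta>..N} b" "\<forall>j\<in>{\<delta>..N}. j \<le> b j"
      "r = (\<Sum>j=\<delta>..N. b j choose j)"
      using Suc.IH[of r] by auto
    have bN: "b N < k'"
    proof (rule ccontr)
      assume "\<not> b N < k'"
      then have "(k' choose N) \<le> (b N choose N)" by (intro binomial_right_mono) simp
      also have "\<dots> \<le> r" unfolding b(5) using b(2) by (intro member_le_sum) auto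
      finally show False using r by simp
    qed
    have bj: "b j < k'" if "j \<in> {\<delta>..N}" for j
      using strict_mono_on_leD[OF b(3), of j N] that bN by auto
    let ?a = "b(Suc N := k')"
    have "strict_mono_on {\<delta>..Suc N} ?a"
    proof (rule strict_mono_onI)
      fix i j assume "i \<in> {\<delta>..Suc N}" "j \<in> {\<delta>..Suc N}" "i < j"
      then show "?a i < ?a j" using bj[of i] strict_mono_onD[OF b(3), of i j]
        by (cases "j = Suc N") auto
    qed
    moreover have "A = (\<Sum>j=\<delta>..Suc N. ?a j choose j)"
      using A b(2,5) by simp
    moreover have "\<forall>j\<in>{\<delta>..Suc N}. j \<le> ?a j" using b(4) k'(2) by auto
    ultimately show ?thesis using b(1,2) by (intro exI[of _ \<delta>] exI[of _ ?a] conjI) (simp_all del: fun_upd_apply)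
  qed
qed

section \<open>Spectral decomposition of Hermitian matrices\<close>

definition adj :: "complex mat \<Rightarrow> complex mat" where
  "adj A = mat (dim_col A) (dim_row A) (\<lambda>(i, j). cnj (A $$ (j, i)))"

lemma adj_carrier: "A \<in> carrier_mat n m \<Longrightarrow> adj A \<in> carrier_mat m n"
  by (auto simp: adj_def)

lemma index_adj [simp]: "A \<in> carrier_mat n m \<Longrightarrow> i < m \<Longrightarrow> j < n \<Longrightarrow> adj A $$ (i, j) = cnj (A $$ (j, i))"
  by (auto simp: adj_def)

lemma index_mult_sum:
  assumes "A \<in> carrier_mat n m" "B \<in> carrier_mat m k" "i < n" "j < k"
  shows "(A * B) $$ (i, j) = (\<Sum>l<m. A $$ (i, l) * B $$ (l, j))"
  using assms by (auto simp: scalar_prod_def lessThan_atLeast0 intro!: sum.cong)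

lemma adj_mult:
  assumes "A \<in> carrier_mat n m" "B \<in> carrier_mat m k"
  shows "adj (A * B) = adj B * adj A"
proof (rule eq_matI)
  have AB: "A * B \<in> carrier_mat n k" using assms by simp
  fix i j assume "i < dim_row (adj B * adj A)" "j < dim_col (adj B * adj A)"
  then have ij: "i < k" "j < n" using assms by (auto simp: adj_def)
  show "adj (A * B) $$ (i, j) = (adj B * adj A) $$ (i, j)"
    unfolding index_adj[OF AB ij] index_mult_sum[OF assms ij(2,1)]
      index_mult_sum[OF adj_carrier[OF assms(2)] adj_carrier[OF assms(1)] ij]
    using assms ij by (auto intro!: sum.cong)
qed (use assms in \<open>auto simp: adj_def\<close>)

lemma adj_adj: "adj (adj A) = A"
  by (rule eq_matI) (auto simp: adj_def)

lemma adj_one: "adj (1\<^sub>m n) = 1\<^sub>m n"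
  by (rule eq_matI) (auto simp: adj_def)

lemma adj_zero: "adj (0\<^sub>m n m) = 0\<^sub>m m n"
  by (rule eq_matI) (auto simp: adj_def)

lemma adj_four_block:
  assumes "A \<in> carrier_mat nr1 nc1" "B \<in> carrier_mat nr1 nc2" "C \<in> carrier_mat nr2 nc1" "D \<in> carrier_mat nr2 nc2"
  shows "adj (four_block_mat A B C D) = four_block_mat (adj A) (adj C) (adj B) (adj D)"
  by (rule eq_matI) (use assms in \<open>auto simp: adj_def\<close>)

text \<open>Complete \<open>v\<close> to a basis and orthogonalise. Gram-Schmidt keeps the first
  vector, and it does not normalise, so the columns are divided by their lengths afterwards.\<close>

lemma ex_unitary_first_col:
  fixes v :: "complex vec"
  assumes v: "v \<in> carrier_vec n" "v \<noteq> 0\<^sub>v n"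
  shows "\<exists>W \<in> carrier_mat n n. adj W * W = 1\<^sub>m n \<and> (\<exists>c. c \<noteq> 0 \<and> col W 0 = c \<cdot>\<^sub>v v)"
proof -
  interpret cof_vec_space n "TYPE(complex)" .
  define b where "b = basis_completion v"
  define ws where "ws = gram_schmidt n b"
  from basis_completion[OF v(1) v(2), folded b_def]
  have dist_b: "distinct b" and indep: "\<not> lin_dep (set b)" and b: "set b \<subseteq> carrier_vec n"
    and hdb: "hd b = v" and len_b: "length b = n" by auto
  have n: "0 < n" using v by (cases n) auto
  from hdb len_b n obtain vs where bv: "b = v # vs" by (cases b) auto
  from gram_schmidt_result[OF b dist_b indep refl, folded ws_def]
  have ws: "set ws \<subseteq> carrier_vec n" "corthogonal ws" "length ws = n"
    by (auto simp: len_b)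
  from gram_schmidt_hd[OF v(1), of vs, folded bv] have "hd ws = v" unfolding ws_def .
  then have ws0: "ws ! 0 = v" using ws(3) n by (simp add: hd_conv_nth[symmetric] length_0_conv[symmetric] del: length_0_conv)
  have wsn: "ws ! i \<in> carrier_vec n" if "i < n" for i using ws that by auto
  define N where "N i = (\<Sum>k<n. (cmod (ws ! i $ k))\<^sup>2)" for i
  have prod: "ws ! j \<bullet>c ws ! i = (\<Sum>k<n. cnj (ws ! i $ k) * ws ! j $ k)" if "i < n" "j < n" for i j
    using wsn[OF that(1)] wsn[OF that(2)] that
    by (auto simp: scalar_prod_def lessThan_atLeast0 mult.commute intro!: sum.cong)
  have N: "ws ! i \<bullet>c ws ! i = of_real (N i)" if "i < n" for i
    unfolding prod[OF that that] N_def of_real_sum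
    by (rule sum.cong) (auto simp: complex_norm_square[symmetric] mult.commute simp del: of_real_power)
  have Npos: "N i > 0" if "i < n" for i
  proof -
    have "N i \<noteq> 0"
      using corthogonalD[OF ws(2), of i i] N[OF that] that ws(3) by auto
    moreover have "N i \<ge> 0" by (auto simp: N_def intro: sum_nonneg)
    ultimately show ?thesis by simp
  qed
  define W where "W = mat n n (\<lambda>(k, i). ws ! i $ k / of_real (sqrt (N i)))"
  have W: "W \<in> carrier_mat n n" by (simp add: W_def)
  have "adj W * W = 1\<^sub>m n"
  proof (rule eq_matI)
    fix i j assume "i < dim_row (1\<^sub>m n)" "j < dim_col (1\<^sub>m n)"
    then have ij: "i < n" "j < n" by auto
    have "(adj W * W) $$ (i, j) = (\<Sum>k<n. cnj (ws ! i $ k) * ws ! j $ k / (of_real (sqrt (N i)) * of_real (sqrt (N j))))"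
      unfolding index_mult_sum[OF adj_carrier[OF W] W ij]
      by (rule sum.cong[OF refl], subst index_adj[OF W]) (use ij in \<open>auto simp: W_def\<close>)
    also have "\<dots> = (ws ! j \<bullet>c ws ! i) / (of_real (sqrt (N i)) * of_real (sqrt (N j)))"
      by (simp add: prod[OF ij] sum_divide_distrib)
    also have "\<dots> = (if i = j then 1 else 0)"
    proof (cases "i = j")
      case True
      have "of_real (sqrt (N j)) * of_real (sqrt (N j)) = (of_real (N j) :: complex)"
        using Npos[OF ij(2)] by (simp flip: of_real_mult)
      then show ?thesis using True N[OF ij(2)] Npos[OF ij(2)] by simp
    next
      case False
      then show ?thesis using corthogonalD[OF ws(2), of j i] ij ws(3) by auto
    qed
    finally show "(adj W * W) $$ (i, j) = 1\<^sub>m n $$ (i, j)" using ij by simp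
  qed (auto simp: W_def adj_def)
  moreover have "col W 0 = (1 / of_real (sqrt (N 0))) \<cdot>\<^sub>v v"
    using n v(1) by (auto simp: W_def ws0 intro!: eq_vecI)
  moreover have "1 / complex_of_real (sqrt (N 0)) \<noteq> 0"
    using Npos[OF n] by simp
  ultimately show ?thesis using W by blast
qed

definition real_diag :: "nat \<Rightarrow> (nat \<Rightarrow> real) \<Rightarrow> complex mat" where
  "real_diag n \<mu> = mat n n (\<lambda>(i, j). if i = j then of_real (\<mu> i) else 0)"

text \<open>Put an eigenvector into the first column of a unitary \<open>W\<close>. The conjugate of
  \<open>A\<close> by \<open>W\<close> has a first column that is zero off the diagonal, being
  Hermitian also such a first row, and so splits into a scalar and a smaller Hermitian block. The
  factored characteristic polynomial is carried along because the signature counts roots with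
  multiplicity.\<close>

lemma hermitian_spectral:
  assumes "A \<in> carrier_mat n n" "adj A = A"
  shows "\<exists>U \<mu>. U \<in> carrier_mat n n \<and> adj U * U = 1\<^sub>m n \<and> A = U * real_diag n \<mu> * adj U \<and>
    char_poly A = (\<Prod>k<n. [:- of_real (\<mu> k), 1:])"
  using assms
proof (induction n arbitrary: A)
  case 0
  then have "char_poly A = 1" by (simp add: char_poly_def char_poly_matrix_def det_def)
  then show ?case using 0 by (intro exI[of _ A]) (auto intro!: eq_matI)
next
  case (Suc m)
  let ?n = "Suc m"
  note A = Suc.prems(1) and herm = Suc.prems(2)
  have "degree (char_poly A) = ?n" using degree_monic_char_poly[OF A] by simp
  then have "\<not> constant (poly (char_poly A))" by (simp add: constant_degree)
  then obtain e where "poly (char_poly A) e = 0" using fundamental_theorem_of_algebra by blast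
  then have "eigenvalue A e" using eigenvalue_root_char_poly[OF A] by simp
  then obtain v where v: "v \<in> carrier_vec ?n" "v \<noteq> 0\<^sub>v ?n" "A *\<^sub>v v = e \<cdot>\<^sub>v v"
    using A by (auto simp: eigenvalue_def eigenvector_def)
  obtain W c where W: "W \<in> carrier_mat ?n ?n" "adj W * W = 1\<^sub>m ?n" "c \<noteq> 0" "col W 0 = c \<cdot>\<^sub>v v"
    using ex_unitary_first_col[OF v(1,2)] by blast
  have aW: "adj W \<in> carrier_mat ?n ?n" by (rule adj_carrier[OF W(1)])
  have WW: "W * adj W = 1\<^sub>m ?n" using mat_mult_left_right_inverse[OF aW W(1,2)] .
  define B where "B = adj W * A * W"
  have B: "B \<in> carrier_mat ?n ?n" unfolding B_def by (rule mult_carrier_mat[OF mult_carrier_mat[OF aW A] W(1)])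
  have hermB: "adj B = B"
    unfolding B_def using A W(1) aW
    by (simp add: adj_mult[of _ ?n ?n _ ?n] adj_adj herm assoc_mult_mat[of _ ?n ?n _ ?n _ ?n])
  have AWB: "A = W * B * adj W"
  proof -
    have "W * B * adj W = (W * adj W) * A * (W * adj W)"
      unfolding B_def using A W(1) aW by (simp add: assoc_mult_mat[of _ ?n ?n _ ?n _ ?n])
    then show ?thesis using A by (simp add: WW)
  qed
  have "A *\<^sub>v col W 0 = e \<cdot>\<^sub>v col W 0"
    unfolding W(4) using A v by (simp add: mult_mat_vec smult_smult_assoc mult.commute)
  have col0: "B $$ (i, 0) = (if i = 0 then e else 0)" if i: "i < ?n" for i
  proof -
    have "A * W \<in> carrier_mat ?n ?n" using A W(1) by simp
    have "B $$ (i, 0) = row (adj W) i \<bullet> (A *\<^sub>v col W 0)"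
      unfolding B_def using A W(1) aW i
      by (simp add: assoc_mult_mat[of _ ?n ?n _ ?n _ ?n] mult_mat_vec_def) 
    also have "\<dots> = e * (row (adj W) i \<bullet> col W 0)"
      using \<open>A *\<^sub>v col W 0 = _\<close> aW W(1) i by simp
    also have "row (adj W) i \<bullet> col W 0 = (adj W * W) $$ (i, 0)"
      using W(1) aW i by simp
    finally show ?thesis using i W(2) by simp
  qed
  \<comment> \<open>The eigenvalue is real because it is a diagonal entry of the Hermitian matrix
    \<open>B\<close>.\<close>
  have e: "e = of_real (Re e)"
    using col0[of 0] arg_cong[OF hermB, of "\<lambda>M. M $$ (0, 0)"] index_adj[OF B, of 0 0]
    by (simp add: complex_eq_iff)
  have row0: "B $$ (0, i) = (if i = 0 then e else 0)" if i: "i < ?n" for i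
    using col0[OF i] arg_cong[OF hermB, of "\<lambda>M. M $$ (0, i)"] index_adj[OF B, of 0 i] i e
    by (auto simp: complex_eq_iff split: if_splits)
  define C where "C = mat m m (\<lambda>(i, j). B $$ (Suc i, Suc j))"
  have C: "C \<in> carrier_mat m m" by (simp add: C_def)
  let ?E = "mat 1 1 (\<lambda>_. e)"
  have BC: "B = four_block_mat ?E (0\<^sub>m 1 m) (0\<^sub>m m 1) C"
    using B by (intro eq_matI) (auto simp: C_def col0 row0)
  have hermC: "adj C = C"
  proof (rule eq_matI)
    fix i j assume "i < dim_row C" "j < dim_col C"
    then have ij: "i < m" "j < m" using C by auto
    then show "adj C $$ (i, j) = C $$ (i, j)"
      using arg_cong[OF hermB, of "\<lambda>M. M $$ (Suc i, Suc j)"] index_adj[OF B, of "Suc i" "Suc j"]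
      by (simp add: index_adj[OF C]) (simp add: C_def)
  qed (auto simp: C_def adj_def)
  from Suc.IH[OF C hermC] obtain U \<mu> where U: "U \<in> carrier_mat m m" "adj U * U = 1\<^sub>m m"
    "C = U * real_diag m \<mu> * adj U" "char_poly C = (\<Prod>k<m. [:- of_real (\<mu> k), 1:])" by blast
  let ?V = "four_block_mat (1\<^sub>m 1) (0\<^sub>m 1 m) (0\<^sub>m m 1) U"
  let ?l = "case_nat (Re e) \<mu>"
  have V: "?V \<in> carrier_mat ?n ?n" using U(1) by (metis four_block_carrier_mat one_carrier_mat plus_1_eq_Suc)
  have aU: "adj U \<in> carrier_mat m m" by (rule adj_carrier[OF U(1)])
  have adjV: "adj ?V = four_block_mat (1\<^sub>m 1) (0\<^sub>m 1 m) (0\<^sub>m m 1) (adj U)"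
    using U(1) by (subst adj_four_block[of _ 1 1 _ m _ m]) (auto simp: adj_one adj_zero)
  have D: "real_diag m \<mu> \<in> carrier_mat m m" by (simp add: real_diag_def)
  have D': "real_diag ?n ?l \<in> carrier_mat ?n ?n" by (simp add: real_diag_def)
  have dia: "real_diag ?n ?l = four_block_mat ?E (0\<^sub>m 1 m) (0\<^sub>m m 1) (real_diag m \<mu>)"
    using e by (intro eq_matI) (auto simp: real_diag_def split: nat.splits)
  have VV: "adj ?V * ?V = 1\<^sub>m ?n"
    unfolding adjV using U(1,2) aU
    by (subst mult_four_block_mat[of _ 1 1 _ m _ m _ _ 1 _ m]) (auto intro!: eq_matI)
  have BV: "B = ?V * real_diag ?n ?l * adj ?V"
    unfolding adjV dia BC U(3) using U(1) aU D
    by (subst mult_four_block_mat[of _ 1 1 _ m _ m _ _ 1 _ m], auto)+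
  let ?U = "W * ?V"
  have aV: "adj ?V \<in> carrier_mat ?n ?n" by (rule adj_carrier[OF V])
  have adjWV: "adj ?U = adj ?V * adj W" by (rule adj_mult[OF W(1) V])
  have "adj ?U * ?U = adj ?V * (adj W * W) * ?V"
    unfolding adjWV using W(1) aW V aV by (simp add: assoc_mult_mat[of _ ?n ?n _ ?n _ ?n])
  also have "\<dots> = 1\<^sub>m ?n" unfolding W(2) using V aV VV by simp
  finally have 1: "adj ?U * ?U = 1\<^sub>m ?n" .
  have 2: "A = ?U * real_diag ?n ?l * adj ?U"
    unfolding adjWV AWB[unfolded BV] using W(1) aW V aV D'
    by (simp add: assoc_mult_mat[of _ ?n ?n _ ?n _ ?n])
  have "similar_mat A B"
    unfolding similar_mat_def
    by (intro exI[of _ W] exI[of _ "adj W"] similar_mat_witI[of _ _ ?n])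
      (use A B W aW WW AWB in auto)
  then have "char_poly A = char_poly B" by (rule char_poly_similar)
  also have "\<dots> = char_poly ?E * char_poly C"
    unfolding BC by (rule char_poly_four_block_zeros_col) (use C in auto)
  also have "char_poly ?E = [:- e, 1:]" by (simp add: char_poly_defs det_def sign_def)
  also have "[:- e, 1:] * char_poly C = (\<Prod>k<?n. [:- of_real (?l k), 1:])"
    unfolding U(4) prod.lessThan_Suc_shift using e by simp
  finally show ?case using 1 2 W(1) V by (intro exI[of _ ?U] exI[of _ ?l] conjI) simp_all
qed

section \<open>Multiplicities of eigenvalues\<close>

lemma order_prod_linear:
  "Polynomial.order c (\<Prod>k\<in>K. [:- f k, 1:]) = card {k \<in> K. f k = (c :: complex)}" if "finite K"
  using that
proof induction
  case (insert k K)
  have "(\<Prod>k\<in>K. [:- f k, 1:]) \<noteq> 0" using insert(1) by simp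
  then have "Polynomial.order c (\<Prod>k\<in>insert k K. [:- f k, 1:]) = Polynomial.order c [:- f k, 1:] + card {k \<in> K. f k = c}"
    using insert by (simp add: order_mult del: mult_pCons_left)
  also have "Polynomial.order c [:- f k, 1:] = (if f k = c then 1 else 0)"
    using order_power_n_n[of c 1] by (auto simp: order_0I)
  also have "{k' \<in> insert k K. f k' = c} = (if f k = c then insert k {k \<in> K. f k = c} else {k \<in> K. f k = c})"
    by auto
  then have "(if f k = c then 1 else 0) + card {k \<in> K. f k = c} = card {k' \<in> insert k K. f k' = c}"
    using insert(1,2) by simp
  finally show ?case .
qed simp

text \<open>The multiplicity of \<open>r\<close> is the number of indices with
  \<open>\<mu> k = r\<close>, and summing over the distinct values regroups the indices. With
  \<open>P\<close> positivity or negativity this turns the signature into sizes of index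
  sets.\<close>

lemma sum_order_eigenvalues:
  fixes A :: "complex mat"
  assumes A: "A \<in> carrier_mat n n" and cp: "char_poly A = (\<Prod>k<n. [:- of_real (\<mu> k), 1:])"
  shows "(\<Sum>r | P r \<and> eigenvalue A (of_real r). Polynomial.order (of_real r) (char_poly A)) = card {k. k < n \<and> P (\<mu> k)}"
proof -
  have ev: "eigenvalue A (of_real r) \<longleftrightarrow> r \<in> \<mu> ` {..<n}" for r
    unfolding eigenvalue_root_char_poly[OF A] cp by (auto simp: poly_prod)
  have "(\<Sum>r | P r \<and> eigenvalue A (of_real r). Polynomial.order (of_real r) (char_poly A))
      = (\<Sum>r\<in>{r \<in> \<mu> ` {..<n}. P r}. card {k \<in> {k \<in> {..<n}. P (\<mu> k)}. \<mu> k = r})"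
    unfolding cp order_prod_linear[OF finite_lessThan] ev
    by (rule sum.cong) (auto intro!: arg_cong[where f = card])
  also have "\<dots> = card {k. k < n \<and> P (\<mu> k)}"
    using sum.group[of "{k \<in> {..<n}. P (\<mu> k)}" "{r \<in> \<mu> ` {..<n}. P r}" \<mu> "\<lambda>_. 1::nat"] by auto
  finally show ?thesis .
qed

section \<open>Polarization\<close>

text \<open>Fix all variables but \<open>x\<close>: the sum is a polynomial in one variable that
  vanishes identically, so its coefficient at \<open>\<gamma> x\<close> is zero. Different indices
  may carry the same monomial, hence the sum of coefficients in the conclusion.\<close>

lemma sum_monomials_eq_0:
  fixes c :: "'k \<Rightarrow> complex" and e :: "'k \<Rightarrow> 'v \<Rightarrow> nat"
  assumes "finite S" "finite K" "\<And>z. (\<Sum>k\<in>K. c k * (\<Prod>i\<in>S. z i ^ e k i)) = 0"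
  shows "sum c {k \<in> K. \<forall>i\<in>S. e k i = \<gamma> i} = 0"
  using assms
proof (induction S arbitrary: K rule: finite_induct)
  case empty
  then show ?case by simp
next
  case (insert x S)
  let ?K = "{k \<in> K. e k x = \<gamma> x}"
  have "(\<Sum>k\<in>?K. c k * (\<Prod>i\<in>S. z i ^ e k i)) = 0" for z
  proof -
    let ?p = "\<Sum>k\<in>K. monom (c k * (\<Prod>i\<in>S. z i ^ e k i)) (e k x)"
    have "poly ?p t = 0" for t
    proof -
      have "(\<Prod>i\<in>S. (z(x := t)) i ^ e k i) = (\<Prod>i\<in>S. z i ^ e k i)" for k
        using insert.hyps by (intro prod.cong) auto
      then show ?thesis
        using insert.prems(2)[of "z(x := t)"] insert.hyps
        by (simp add: poly_sum poly_monom mult.assoc mult.commute mult.left_commute)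
    qed
    then have "?p = 0" using poly_all_0_iff_0 by blast
    then have "coeff ?p (\<gamma> x) = 0" by simp
    then show ?thesis
      using insert.prems(1) by (simp add: coeff_sum sum.inter_filter)
  qed
  then have "sum c {k \<in> ?K. \<forall>i\<in>S. e k i = \<gamma> i} = 0"
    using insert.IH[of ?K] insert.prems(1) by auto
  moreover have "{k \<in> ?K. \<forall>i\<in>S. e k i = \<gamma> i} = {k \<in> K. \<forall>i\<in>insert x S. e k i = \<gamma> i}" by auto
  ultimately show ?case by simp
qed

lemma poly_zero_on_reals:
  fixes p :: "complex poly"
  assumes "\<And>x :: real. poly p (of_real x) = 0"
  shows "p = 0"
proof (rule ccontr)
  assume "p \<noteq> 0"
  then have "finite {z. poly p z = 0}" by (rule poly_roots_finite)
  moreover have "range complex_of_real \<subseteq> {z. poly p z = 0}" using assms by auto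
  ultimately have "finite (range complex_of_real)" by (rule finite_subset[rotated])
  then show False using finite_imageD[of complex_of_real UNIV] inj_of_real infinite_UNIV_char_0 by blast
qed

text \<open>Write \<open>s = x + \<i> y\<close>: a polynomial in real \<open>x\<close> and \<open>y\<close> that vanishes also vanishes for complex \<open>x\<close> and \<open>y\<close>.\<close>

lemma polarize_variable:
  fixes c :: "'k \<Rightarrow> complex"
  assumes "\<And>s. (\<Sum>k\<in>K. c k * s ^ a k * cnj s ^ b k) = 0"
  shows "(\<Sum>k\<in>K. c k * s ^ a k * t ^ b k) = 0"
proof -
  have 1: "(\<Sum>k\<in>K. c k * (x + \<i> * of_real y) ^ a k * (x - \<i> * of_real y) ^ b k) = 0" for x and y :: real
  proof -
    let ?p = "\<Sum>k\<in>K. Polynomial.smult (c k) ([:\<i> * of_real y, 1:] ^ a k * [:- (\<i> * of_real y), 1:] ^ b k)"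
    have "?p = 0"
    proof (rule poly_zero_on_reals)
      fix r :: real
      show "poly ?p (of_real r) = 0"
        using assms[of "of_real r + \<i> * of_real y"] by (simp add: poly_sum algebra_simps)
    qed
    then have "poly ?p x = 0" by simp
    then show ?thesis by (simp add: poly_sum algebra_simps)
  qed
  have 2: "(\<Sum>k\<in>K. c k * (x + \<i> * y) ^ a k * (x - \<i> * y) ^ b k) = 0" for x y
  proof -
    let ?p = "\<Sum>k\<in>K. Polynomial.smult (c k) ([:x, \<i>:] ^ a k * [:x, - \<i>:] ^ b k)"
    have "?p = 0"
    proof (rule poly_zero_on_reals)
      fix r :: real
      show "poly ?p (of_real r) = 0"
        using 1[of x r] by (simp add: poly_sum algebra_simps)
    qed
    then have "poly ?p y = 0" by simp
    then show ?thesis by (simp add: poly_sum algebra_simps)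
  qed
  have "(s + t) / 2 + \<i> * ((s - t) / (2 * \<i>)) = s" "(s + t) / 2 - \<i> * ((s - t) / (2 * \<i>)) = t"
    by (simp_all add: field_simps)
  then show ?thesis using 2[of "(s + t) / 2" "(s - t) / (2 * \<i>)"] by simp
qed

text \<open>The variables of \<open>w\<close> are released one at a time: \<open>S\<close> is the
  set of positions at which \<open>w\<close> is no longer tied to the conjugate of \<open>z\<close>,
  and each step applies \<open>polarize_variable\<close>.\<close>

lemma polarize:
  fixes c :: "'k \<Rightarrow> complex" and a b :: "'k \<Rightarrow> 'v::finite \<Rightarrow> nat"
  assumes "\<And>z. (\<Sum>k\<in>K. c k * (\<Prod>i\<in>UNIV. z i ^ a k i) * (\<Prod>i\<in>UNIV. cnj (z i) ^ b k i)) = 0"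
  shows "(\<Sum>k\<in>K. c k * (\<Prod>i\<in>UNIV. z i ^ a k i) * (\<Prod>i\<in>UNIV. w i ^ b k i)) = 0"
proof -
  have "(\<Sum>k\<in>K. c k * (\<Prod>i\<in>UNIV. z i ^ a k i) * (\<Prod>i\<in>UNIV. w i ^ b k i)) = 0"
    if "finite S" "\<And>i. i \<notin> S \<Longrightarrow> w i = cnj (z i)" for S and z w :: "'v \<Rightarrow> complex"
    using that
  proof (induction S arbitrary: z w rule: finite_induct)
    case empty
    then have "w = (\<lambda>i. cnj (z i))" by auto
    then show ?case using assms[of z] by simp
  next
    case (insert x S)
    have split: "(\<Prod>i\<in>UNIV. (f(x := s)) i ^ e i) = s ^ e x * (\<Prod>i\<in>UNIV - {x}. f i ^ e i)"
      for f :: "'v \<Rightarrow> complex" and s e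
      by (subst prod.remove[of _ x]) (auto intro!: prod.cong)
    let ?c = "\<lambda>k. c k * (\<Prod>i\<in>UNIV - {x}. z i ^ a k i) * (\<Prod>i\<in>UNIV - {x}. w i ^ b k i)"
    have "(\<Sum>k\<in>K. ?c k * s ^ a k x * cnj s ^ b k x) = 0" for s
      using insert.IH[of "w(x := cnj s)" "z(x := s)"] insert.prems
      unfolding split by (simp add: mult_ac)
    then have "(\<Sum>k\<in>K. ?c k * z x ^ a k x * w x ^ b k x) = 0"
      by (rule polarize_variable)
    moreover have "(\<Prod>i\<in>UNIV. z i ^ a k i) = z x ^ a k x * (\<Prod>i\<in>UNIV - {x}. z i ^ a k i)"
      "(\<Prod>i\<in>UNIV. w i ^ b k i) = w x ^ b k x * (\<Prod>i\<in>UNIV - {x}. w i ^ b k i)" for k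
      by (simp_all add: prod.remove)
    ultimately show ?case by (simp add: mult_ac)
  qed
  from this[of UNIV] show ?thesis by simp
qed

section \<open>Coefficients of mixed polynomials\<close>

text \<open>Polarization makes \<open>z\<close> and its conjugate independent, after which
  coefficients are extracted first in \<open>z\<close> and then in the second set of
  variables.\<close>

lemma sum_mixed_monomials_eq_0:
  fixes c :: "'k \<Rightarrow> complex" and a b :: "'k \<Rightarrow> 'n::finite monom"
  assumes K: "finite K" and "\<And>z. (\<Sum>k\<in>K. c k * eval_monom (a k) z * cnj (eval_monom (b k) z)) = 0"
  shows "sum c {k \<in> K. a k = \<alpha> \<and> b k = \<beta>} = 0"
proof -
  let ?a = "\<lambda>k. Poly_Mapping.lookup (a k)" and ?b = "\<lambda>k. Poly_Mapping.lookup (b k)"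
  have *: "(\<Sum>k\<in>K. c k * (\<Prod>i\<in>UNIV. z i ^ ?a k i) * (\<Prod>i\<in>UNIV. w i ^ ?b k i)) = 0" for z w
    by (rule polarize) (use assms(2) in \<open>simp add: eval_monom_def\<close>)
  have "(\<Sum>k\<in>{k \<in> K. a k = \<alpha>}. c k * (\<Prod>i\<in>UNIV. w i ^ ?b k i)) = 0" for w
    using sum_monomials_eq_0[OF finite_UNIV K, of "\<lambda>k. c k * (\<Prod>i\<in>UNIV. w i ^ ?b k i)" ?a "Poly_Mapping.lookup \<alpha>"]
      *[of _ w] by (simp add: mult_ac poly_mapping_eq_iff fun_eq_iff)
  then have "sum c {k \<in> {k \<in> K. a k = \<alpha>}. \<forall>i\<in>UNIV. ?b k i = Poly_Mapping.lookup \<beta> i} = 0"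
    using K by (intro sum_monomials_eq_0) auto
  moreover have "{k \<in> {k \<in> K. a k = \<alpha>}. \<forall>i\<in>UNIV. ?b k i = Poly_Mapping.lookup \<beta> i} = {k \<in> K. a k = \<alpha> \<and> b k = \<beta>}"
    by (auto intro: poly_mapping_eqI)
  ultimately show ?thesis by simp
qed

lemma eval_hol_superset:
  assumes "finite K" "Poly_Mapping.keys f \<subseteq> K"
  shows "eval_hol f z = (\<Sum>\<alpha>\<in>K. Poly_Mapping.lookup f \<alpha> * eval_monom \<alpha> z)"
  unfolding eval_hol_def
  by (rule sum.mono_neutral_left) (use assms in \<open>auto simp: in_keys_iff\<close>)

lemma eval_mixed_superset:
  assumes "finite K" "Poly_Mapping.keys M \<subseteq> K"
  shows "eval_mixed M z = (\<Sum>(\<alpha>, \<beta>)\<in>K. Poly_Mapping.lookup M (\<alpha>, \<beta>) * eval_monom \<alpha> z * cnj (eval_monom \<beta> z))"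
  unfolding eval_mixed_def
  by (rule sum.mono_neutral_left) (use assms in \<open>auto simp: in_keys_iff\<close>)

text \<open>Both sums of squares expand over pairs of monomials, with the entries of their Hermitian
  coefficient matrices as coefficients. Equal functions therefore have equal matrices.\<close>

lemma gram_coeffs_eq:
  fixes f :: "'i \<Rightarrow> 'n::finite hol_poly" and g :: "'j \<Rightarrow> 'n hol_poly"
  assumes I: "finite I" and J: "finite J"
    and eq: "\<And>z. (\<Sum>i\<in>I. (cmod (eval_hol (f i) z))\<^sup>2) = (\<Sum>j\<in>J. (cmod (eval_hol (g j) z))\<^sup>2)"
  shows "(\<Sum>i\<in>I. Poly_Mapping.lookup (f i) \<alpha> * cnj (Poly_Mapping.lookup (f i) \<beta>))
       = (\<Sum>j\<in>J. Poly_Mapping.lookup (g j) \<alpha> * cnj (Poly_Mapping.lookup (g j) \<beta>))"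
proof -
  define K where "K = insert \<alpha> (insert \<beta> ((\<Union>i\<in>I. Poly_Mapping.keys (f i)) \<union> (\<Union>j\<in>J. Poly_Mapping.keys (g j))))"
  have K: "finite K" "\<alpha> \<in> K" "\<beta> \<in> K" using I J by (auto simp: K_def)
  have keys: "\<And>i. i \<in> I \<Longrightarrow> Poly_Mapping.keys (f i) \<subseteq> K" "\<And>j. j \<in> J \<Longrightarrow> Poly_Mapping.keys (g j) \<subseteq> K"
    by (auto simp: K_def)
  define F where "F \<gamma> \<gamma>' = (\<Sum>i\<in>I. Poly_Mapping.lookup (f i) \<gamma> * cnj (Poly_Mapping.lookup (f i) \<gamma>'))" for \<gamma> \<gamma>'
  define G where "G \<gamma> \<gamma>' = (\<Sum>j\<in>J. Poly_Mapping.lookup (g j) \<gamma> * cnj (Poly_Mapping.lookup (g j) \<gamma>'))" for \<gamma> \<gamma>'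
  have expand: "of_real (\<Sum>i\<in>I. (cmod (eval_hol (f i) z))\<^sup>2) = (\<Sum>(\<gamma>, \<gamma>')\<in>K \<times> K.
      (\<Sum>i\<in>I. Poly_Mapping.lookup (f i) \<gamma> * cnj (Poly_Mapping.lookup (f i) \<gamma>')) * eval_monom \<gamma> z * cnj (eval_monom \<gamma>' z))"
    if "\<And>i. i \<in> I \<Longrightarrow> Poly_Mapping.keys (f i) \<subseteq> K" for I :: "'k set" and f :: "'k \<Rightarrow> 'n hol_poly" and z
  proof -
    have "of_real (\<Sum>i\<in>I. (cmod (eval_hol (f i) z))\<^sup>2) = (\<Sum>i\<in>I. eval_hol (f i) z * cnj (eval_hol (f i) z))"
      by (simp only: of_real_sum complex_norm_square)
    also have "\<dots> = (\<Sum>i\<in>I. \<Sum>(\<gamma>, \<gamma>')\<in>K \<times> K. Poly_Mapping.lookup (f i) \<gamma> * eval_monom \<gamma> z *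
        (cnj (Poly_Mapping.lookup (f i) \<gamma>') * cnj (eval_monom \<gamma>' z)))"
      by (rule sum.cong[OF refl])
        (simp add: eval_hol_superset[OF K(1) that] sum_product sum.cartesian_product)
    also have "\<dots> = (\<Sum>(\<gamma>, \<gamma>')\<in>K \<times> K. \<Sum>i\<in>I. Poly_Mapping.lookup (f i) \<gamma> * eval_monom \<gamma> z *
        (cnj (Poly_Mapping.lookup (f i) \<gamma>') * cnj (eval_monom \<gamma>' z)))"
      by (subst sum.swap) (simp add: case_prod_unfold)
    finally show ?thesis by (simp add: sum_distrib_left sum_distrib_right mult_ac)
  qed
  have "(\<Sum>k\<in>K \<times> K. (F (fst k) (snd k) - G (fst k) (snd k)) * eval_monom (fst k) z * cnj (eval_monom (snd k) z)) = 0" for z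
  proof -
    have "(\<Sum>(\<gamma>, \<gamma>')\<in>K \<times> K. F \<gamma> \<gamma>' * eval_monom \<gamma> z * cnj (eval_monom \<gamma>' z))
        = (\<Sum>(\<gamma>, \<gamma>')\<in>K \<times> K. G \<gamma> \<gamma>' * eval_monom \<gamma> z * cnj (eval_monom \<gamma>' z))"
      unfolding F_def G_def using keys by (simp only: expand[symmetric] eq)
    then show ?thesis by (simp add: case_prod_unfold left_diff_distrib sum_subtractf)
  qed
  then have "(\<Sum>k\<in>{k \<in> K \<times> K. fst k = \<alpha> \<and> snd k = \<beta>}. F (fst k) (snd k) - G (fst k) (snd k)) = 0"
    using K(1) by (intro sum_mixed_monomials_eq_0) auto
  moreover have "{k \<in> K \<times> K. fst k = \<alpha> \<and> snd k = \<beta>} = {(\<alpha>, \<beta>)}" using K by auto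
  ultimately show ?thesis by (simp add: F_def G_def)
qed

text \<open>A real value equals its conjugate, and conjugation swaps the two exponents; comparing
  coefficients gives the symmetry that makes \<open>coeff_mat\<close> Hermitian.\<close>

lemma hermitian_coeffs:
  fixes M :: "'n::finite mixed_poly"
  assumes "hermitian_poly M" 
  shows "Poly_Mapping.lookup M (\<beta>, \<alpha>) = cnj (Poly_Mapping.lookup M (\<alpha>, \<beta>))"
proof -
  let ?L = "Poly_Mapping.lookup M"
  define K where "K = insert \<alpha> (insert \<beta> (fst ` Poly_Mapping.keys M \<union> snd ` Poly_Mapping.keys M))"
  have K: "finite K" "\<alpha> \<in> K" "\<beta> \<in> K" by (auto simp: K_def)
  have sub: "Poly_Mapping.keys M \<subseteq> K \<times> K" by (force simp: K_def)
  have ev: "eval_mixed M z = (\<Sum>(\<gamma>, \<gamma>')\<in>K \<times> K. ?L (\<gamma>, \<gamma>') * eval_monom \<gamma> z * cnj (eval_monom \<gamma>' z))" for z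
    by (rule eval_mixed_superset) (use K sub in auto)
  have ev': "cnj (eval_mixed M z) = (\<Sum>(\<gamma>, \<gamma>')\<in>K \<times> K. cnj (?L (\<gamma>', \<gamma>)) * eval_monom \<gamma> z * cnj (eval_monom \<gamma>' z))" for z
    unfolding ev sum.cartesian_product[symmetric]
    by (subst sum.swap) (simp add: mult_ac)
  have "(\<Sum>k\<in>K \<times> K. (?L k - cnj (?L (snd k, fst k))) * eval_monom (fst k) z * cnj (eval_monom (snd k) z)) = 0" for z
  proof -
    have "cnj (eval_mixed M z) = eval_mixed M z"
      using assms by (simp add: hermitian_poly_def Reals_cnj_iff)
    then show ?thesis
      unfolding ev' unfolding ev by (simp add: case_prod_unfold left_diff_distrib sum_subtractf)
  qed
  then have "(\<Sum>k\<in>{k \<in> K \<times> K. fst k = \<beta> \<and> snd k = \<alpha>}. ?L k - cnj (?L (snd k, fst k))) = 0"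
    using K(1) by (intro sum_mixed_monomials_eq_0) auto
  moreover have "{k \<in> K \<times> K. fst k = \<beta> \<and> snd k = \<alpha>} = {(\<beta>, \<alpha>)}" using K by auto
  ultimately show ?thesis by simp
qed

lemma hol_poly_eq_sum:
  assumes "finite K" "Poly_Mapping.keys f \<subseteq> K"
  shows "f = (\<Sum>\<alpha>\<in>K. hol_scale (Poly_Mapping.lookup f \<alpha>) (Poly_Mapping.single \<alpha> 1))"
  by (rule poly_mapping_eqI)
    (use assms in \<open>auto simp: lookup_sum lookup_single when_def in_keys_iff if_distrib sum.delta cong: if_cong\<close>)

text \<open>If some \<open>f i0\<close> were outside the span, a linear functional
  \<open>\<phi>\<close> would vanish on every \<open>g j\<close> and be 1 at \<open>f i0\<close>.
  Applying \<open>\<phi>\<close> and its conjugate to the common coefficient matrix equates the sums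
  of squared moduli of \<open>\<phi>\<close> over the two families, so that a sum containing a 1
  would be zero.\<close>

lemma span_of_sqnorm_eq:
  fixes f :: "'i \<Rightarrow> 'n::finite hol_poly" and g :: "'j \<Rightarrow> 'n hol_poly"
  assumes I: "finite I" and J: "finite J"
    and eq: "\<And>z. (\<Sum>i\<in>I. (cmod (eval_hol (f i) z))\<^sup>2) = (\<Sum>j\<in>J. (cmod (eval_hol (g j) z))\<^sup>2)"
  shows "f ` I \<subseteq> hol.span (g ` J)"
proof (rule ccontr)
  assume "\<not> f ` I \<subseteq> hol.span (g ` J)"
  then obtain i0 where i0: "i0 \<in> I" "f i0 \<notin> hol.span (g ` J)" by auto
  interpret vp: vector_space_pair "hol_scale :: complex \<Rightarrow> 'n hol_poly \<Rightarrow> _" "(*) :: complex \<Rightarrow> complex \<Rightarrow> complex"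
    by unfold_locales (auto simp: algebra_simps)
  obtain B where B: "B \<subseteq> g ` J" "hol.independent B" "g ` J \<subseteq> hol.span B"
    by (rule hol.maximal_independent_subset)
  have spanB: "hol.span B = hol.span (g ` J)"
    using B(1,3) by (metis hol.span_mono hol.span_span subset_antisym)
  have "hol.independent (insert (f i0) B)"
    using i0(2) B(2) spanB by (intro hol.independent_insertI) auto
  then obtain \<phi> where \<phi>: "Vector_Spaces.linear hol_scale (*) \<phi>" "\<And>x. x \<in> insert (f i0) B \<Longrightarrow> \<phi> x = (if x = f i0 then 1 else 0)"
    using vp.linear_independent_extend[of "insert (f i0) B" "\<lambda>x. if x = f i0 then 1 else 0"] by blast
  interpret l: Vector_Spaces.linear hol_scale "(*)" \<phi> by (rule \<phi>(1))
  have fB: "f i0 \<notin> B" using i0(2) spanB hol.span_base by blast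
  have \<phi>g: "\<phi> (g j) = 0" if "j \<in> J" for j
  proof -
    have "g j \<in> hol.span B" using B(3) that by auto
    then show ?thesis
      by (rule vp.linear_eq_0_on_span[OF \<phi>(1), rotated]) (use \<phi>(2) fB in auto)
  qed
  define K where "K = (\<Union>i\<in>I. Poly_Mapping.keys (f i)) \<union> (\<Union>j\<in>J. Poly_Mapping.keys (g j))"
  have K: "finite K" using I J by (auto simp: K_def)
  have keys: "\<And>i. i \<in> I \<Longrightarrow> Poly_Mapping.keys (f i) \<subseteq> K" "\<And>j. j \<in> J \<Longrightarrow> Poly_Mapping.keys (g j) \<subseteq> K"
    by (auto simp: K_def)
  define t where "t \<alpha> = \<phi> (Poly_Mapping.single \<alpha> 1)" for \<alpha>
  have expand: "(\<Sum>i\<in>I. \<phi> (f i) * cnj (\<phi> (f i))) = (\<Sum>(\<alpha>, \<beta>)\<in>K \<times> K. t \<alpha> * cnj (t \<beta>) *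
      (\<Sum>i\<in>I. Poly_Mapping.lookup (f i) \<alpha> * cnj (Poly_Mapping.lookup (f i) \<beta>)))"
    if "\<And>i. i \<in> I \<Longrightarrow> Poly_Mapping.keys (f i) \<subseteq> K" for I :: "'k set" and f :: "'k \<Rightarrow> 'n hol_poly"
  proof -
    have \<phi>f: "\<phi> (f i) = (\<Sum>\<alpha>\<in>K. Poly_Mapping.lookup (f i) \<alpha> * t \<alpha>)" if "i \<in> I" for i
      by (subst hol_poly_eq_sum[OF K \<open>\<And>i. i \<in> I \<Longrightarrow> _\<close>[OF that]]) (simp add: l.sum l.scale t_def)
    have "(\<Sum>i\<in>I. \<phi> (f i) * cnj (\<phi> (f i))) = (\<Sum>i\<in>I. \<Sum>(\<alpha>, \<beta>)\<in>K \<times> K.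
        Poly_Mapping.lookup (f i) \<alpha> * t \<alpha> * (cnj (Poly_Mapping.lookup (f i) \<beta>) * cnj (t \<beta>)))"
      by (rule sum.cong[OF refl]) (simp add: \<phi>f sum_product sum.cartesian_product)
    also have "\<dots> = (\<Sum>(\<alpha>, \<beta>)\<in>K \<times> K. \<Sum>i\<in>I.
        Poly_Mapping.lookup (f i) \<alpha> * t \<alpha> * (cnj (Poly_Mapping.lookup (f i) \<beta>) * cnj (t \<beta>)))"
      by (subst sum.swap) (simp add: case_prod_unfold)
    also have "\<dots> = (\<Sum>(\<alpha>, \<beta>)\<in>K \<times> K. t \<alpha> * cnj (t \<beta>) *
      (\<Sum>i\<in>I. Poly_Mapping.lookup (f i) \<alpha> * cnj (Poly_Mapping.lookup (f i) \<beta>)))"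
      unfolding sum_distrib_left case_prod_unfold by (intro sum.cong refl) (simp only: mult_ac)
    finally show ?thesis .
  qed
  have "(\<Sum>i\<in>I. \<phi> (f i) * cnj (\<phi> (f i))) = (\<Sum>j\<in>J. \<phi> (g j) * cnj (\<phi> (g j)))"
    using keys by (simp only: expand gram_coeffs_eq[OF I J eq])
  then have "complex_of_real (\<Sum>i\<in>I. (cmod (\<phi> (f i)))\<^sup>2) = 0"
    using \<phi>g by (simp only: of_real_sum complex_norm_square) simp
  then have "(\<Sum>i\<in>I. (cmod (\<phi> (f i)))\<^sup>2) = 0" by (simp only: of_real_eq_0_iff)
  then have "(cmod (\<phi> (f i0)))\<^sup>2 = 0"
    using I i0(1) by (subst (asm) sum_nonneg_eq_0_iff) auto
  then show False using \<phi>(2)[of "f i0"] by simp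
qed

section \<open>Monomials\<close>

definition mult_monom :: "'n monom \<Rightarrow> 'n hol_poly \<Rightarrow> 'n hol_poly" where
  "mult_monom \<mu> f = Poly_Mapping.single \<mu> 1 * f"

lemma lookup_mult_monom: "Poly_Mapping.lookup (mult_monom \<mu> f) (\<mu> + \<alpha>) = Poly_Mapping.lookup f \<alpha>"
proof -
  have "Poly_Mapping.lookup (mult_monom \<mu> f) (\<mu> + \<alpha>) =
    (\<Sum>l. (1 when \<mu> = l) * (\<Sum>q. Poly_Mapping.lookup f q when \<mu> + \<alpha> = l + q))"
    by (simp add: mult_monom_def lookup_mult lookup_single)
  also have "\<dots> = (\<Sum>q. Poly_Mapping.lookup f q when \<alpha> = q)"
    by (simp add: when_mult)
  finally show ?thesis by simp
qed

lemma keys_mult_monom: "Poly_Mapping.keys (mult_monom \<mu> f) = (+) \<mu> ` Poly_Mapping.keys f"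
proof (rule subset_antisym)
  show "Poly_Mapping.keys (mult_monom \<mu> f) \<subseteq> (+) \<mu> ` Poly_Mapping.keys f"
    using keys_mult[of "Poly_Mapping.single \<mu> 1" f] by (auto simp: mult_monom_def)
  show "(+) \<mu> ` Poly_Mapping.keys f \<subseteq> Poly_Mapping.keys (mult_monom \<mu> f)"
    by (auto simp: in_keys_iff lookup_mult_monom)
qed

lemma eval_monom_add: "eval_monom (\<alpha> + \<beta>) z = eval_monom \<alpha> z * eval_monom \<beta> z"
  by (simp add: eval_monom_def lookup_add power_add prod.distrib)

lemma eval_mult_monom: "eval_hol (mult_monom \<mu> f) z = eval_monom \<mu> z * eval_hol f z"
proof -
  have "inj_on ((+) \<mu>) (Poly_Mapping.keys f)" by (simp add: inj_on_def)
  then show ?thesis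
    by (simp add: eval_hol_def keys_mult_monom sum.reindex lookup_mult_monom eval_monom_add sum_distrib_left mult_ac)
qed

lemma hol_scale_eq_mult: "hol_scale c f = Poly_Mapping.single 0 c * f"
  by (simp add: hol_scale_def mult_map_scale_conv_mult)

lemma mult_monom_linear: "Modules.module_hom hol_scale hol_scale (mult_monom \<mu>)"
  by unfold_locales (simp_all add: mult_monom_def hol_scale_eq_mult algebra_simps)

lemma mdeg_add: "mdeg (\<alpha> + \<beta>) = mdeg \<alpha> + mdeg \<beta>"
  by (simp add: mdeg_def lookup_add sum.distrib)

text \<open>Words rather than monomials index the expansion of the power of the norm, since every
  word then occurs with coefficient 1 and no multinomial weights appear.\<close>

fun word_monom :: "'n list \<Rightarrow> 'n monom" where
  "word_monom [] = 0"
| "word_monom (i # w) = Poly_Mapping.single i 1 + word_monom w"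

lemma mdeg_single: "mdeg (Poly_Mapping.single i 1) = 1"
  by (simp add: mdeg_def lookup_single when_def)

lemma mdeg_word_monom: "mdeg (word_monom w) = length w"
proof (induction w)
  case Nil
  then show ?case by (simp add: mdeg_def)
qed (simp add: mdeg_add mdeg_single del: One_nat_def)

lemma eval_monom_single: "eval_monom (Poly_Mapping.single i 1) z = z i"
proof -
  have "(\<Prod>j\<in>UNIV. z j ^ Poly_Mapping.lookup (Poly_Mapping.single i (1::nat)) j) = (\<Prod>j\<in>UNIV. if j = i then z i else 1)"
    by (rule prod.cong) (auto simp: lookup_single)
  then show ?thesis by (simp add: eval_monom_def)
qed

lemma sqnorm_vec_power:
  "sqnorm_vec z ^ l = (\<Sum>w | length w = l. (cmod (eval_monom (word_monom w) z))\<^sup>2)"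
proof (induction l)
  case 0
  then show ?case by (simp add: eval_monom_def)
next
  case (Suc l)
  have "{w :: 'a list. length w = Suc l} = (\<lambda>(i, w). i # w) ` (UNIV \<times> {w. length w = l})"
    by (auto simp: length_Suc_conv)
  moreover have "inj_on (\<lambda>(i :: 'a, w). i # w) (UNIV \<times> {w. length w = l})"
    by (auto simp: inj_on_def)
  ultimately have "(\<Sum>w | length w = Suc l. (cmod (eval_monom (word_monom w) z))\<^sup>2)
      = (\<Sum>(i, w)\<in>UNIV \<times> {w. length w = l}. (cmod (z i))\<^sup>2 * (cmod (eval_monom (word_monom w) z))\<^sup>2)"
    by (simp add: sum.reindex case_prod_unfold eval_monom_add eval_monom_single norm_mult power_mult_distrib
        del: One_nat_def)
  also have "\<dots> = sqnorm_vec z * (\<Sum>w | length w = l. (cmod (eval_monom (word_monom w) z))\<^sup>2)"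
    by (simp add: sqnorm_vec_def sum_product sum.cartesian_product)
  finally show ?case using Suc.IH by simp
qed

lemma finite_words: "finite {w :: 'n::finite list. length w = l}"
  using finite_lists_length_eq[of "UNIV :: 'n set" l] by simp

lemma card_monoms_of_degree:
  "card {\<alpha> :: 'n::finite monom. mdeg \<alpha> = l} \<le> (card (UNIV :: 'n set) - 1 + l) choose l"
proof -
  let ?n = "card (UNIV :: 'n set)"
  obtain e where e: "bij_betw e {..<?n} (UNIV :: 'n set)"
    using ex_bij_betw_nat_finite[of "UNIV :: 'n set"] by (auto simp: lessThan_atLeast0)
  let ?F = "\<lambda>\<alpha> :: 'n monom. map (\<lambda>j. Poly_Mapping.lookup \<alpha> (e j)) [0..<?n]"
  let ?L = "{xs :: nat list. length xs = ?n \<and> sum_list xs = l}"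
  have n: "0 < ?n" by (simp add: card_gt_0_iff)
  have cardL: "card ?L = (?n - 1 + l) choose l"
    unfolding card_length_sum_list using n by (simp add: add.commute)
  then have "finite ?L" by (intro card_ge_0_finite) simp
  moreover have "inj_on ?F {\<alpha>. mdeg \<alpha> = l}"
  proof (rule inj_onI)
    fix \<alpha> \<beta> assume eq: "?F \<alpha> = ?F \<beta>"
    show "\<alpha> = \<beta>"
    proof (rule poly_mapping_eqI)
      fix i
      have "i \<in> e ` {..<?n}" using e by (auto simp: bij_betw_def)
      then show "Poly_Mapping.lookup \<alpha> i = Poly_Mapping.lookup \<beta> i" using eq by auto
    qed
  qed
  moreover have "?F ` {\<alpha>. mdeg \<alpha> = l} \<subseteq> ?L"
  proof (rule image_subsetI)
    fix \<alpha> :: "'n monom" assume "\<alpha> \<in> {\<alpha>. mdeg \<alpha> = l}"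
    then have "(\<Sum>j<?n. Poly_Mapping.lookup \<alpha> (e j)) = l"
      using sum.reindex_bij_betw[OF e, of "Poly_Mapping.lookup \<alpha>"] by (simp add: mdeg_def)
    then show "?F \<alpha> \<in> ?L" by (simp add: interv_sum_list_conv_sum_set_nat lessThan_atLeast0)
  qed
  ultimately have "card {\<alpha> :: 'n monom. mdeg \<alpha> = l} \<le> card ?L" by (intro card_inj_on_le)
  then show ?thesis unfolding cardL .
qed

section \<open>Leading monomials\<close>

text \<open>Monomials are compared through a weight; it need only be injective on the monomials at hand.\<close>

definition is_lead :: "('n monom \<Rightarrow> nat) \<Rightarrow> 'n monom \<Rightarrow> 'n hol_poly \<Rightarrow> bool" where
  "is_lead \<omega> \<alpha> f \<longleftrightarrow> \<alpha> \<in> Poly_Mapping.keys f \<and> (\<forall>\<beta>\<in>Poly_Mapping.keys f. \<omega> \<beta> \<le> \<omega> \<alpha>)"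

text \<open>Choose one element of \<open>V\<close> for each leading monomial. Subtracting a suitable
  multiple of the chosen element cancels the top term of any \<open>f\<close> in \<open>V\<close>
  and lowers its weight, so the chosen elements span \<open>V\<close> and there are at least as many
  of them as independent vectors.\<close>

lemma card_independent_le_leads:
  fixes \<omega> :: "'n::finite monom \<Rightarrow> nat"
  assumes V: "hol.subspace V" "\<And>f. f \<in> V \<Longrightarrow> Poly_Mapping.keys f \<subseteq> K"
    and K: "finite K" "inj_on \<omega> K" and T: "hol.independent T" "T \<subseteq> V"
  shows "card T \<le> card {\<alpha>. \<exists>f\<in>V. is_lead \<omega> \<alpha> f}"
proof -
  let ?L = "{\<alpha>. \<exists>f\<in>V. is_lead \<omega> \<alpha> f}"
  have LK: "?L \<subseteq> K" using V(2) by (auto simp: is_lead_def)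
  then have finL: "finite ?L" using K(1) by (rule finite_subset)
  obtain g where g: "\<And>\<alpha>. \<alpha> \<in> ?L \<Longrightarrow> g \<alpha> \<in> V \<and> is_lead \<omega> \<alpha> (g \<alpha>)"
    using bchoice[of ?L "\<lambda>\<alpha> f. f \<in> V \<and> is_lead \<omega> \<alpha> f"] by auto
  have span: "f \<in> hol.span (g ` ?L)" if "f \<in> V" "\<And>\<beta>. \<beta> \<in> Poly_Mapping.keys f \<Longrightarrow> \<omega> \<beta> < n" for f n
    using that
  proof (induction n arbitrary: f)
    case 0
    then have "Poly_Mapping.keys f = {}" by (intro equals0I) auto
    then show ?case by (simp add: hol.span_zero)
  next
    case (Suc n)
    show ?case
    proof (cases "\<exists>\<alpha>\<in>Poly_Mapping.keys f. \<omega> \<alpha> = n")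
      case False
      then show ?thesis using Suc by (meson less_SucE)
    next
      case True
      then obtain \<alpha> where \<alpha>: "\<alpha> \<in> Poly_Mapping.keys f" "\<omega> \<alpha> = n" by blast
      then have L: "\<alpha> \<in> ?L" using Suc.prems by (auto simp: is_lead_def less_Suc_eq_le)
      let ?c = "Poly_Mapping.lookup f \<alpha> / Poly_Mapping.lookup (g \<alpha>) \<alpha>"
      let ?f = "f - hol_scale ?c (g \<alpha>)"
      have g\<alpha>: "g \<alpha> \<in> V" "Poly_Mapping.lookup (g \<alpha>) \<alpha> \<noteq> 0"
        "\<And>\<beta>. \<beta> \<in> Poly_Mapping.keys (g \<alpha>) \<Longrightarrow> \<omega> \<beta> \<le> n"
        using g[OF L] \<alpha>(2) by (auto simp: is_lead_def in_keys_iff)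
      have "?f \<in> V" using Suc.prems(1) g\<alpha>(1) V(1) by (simp add: hol.subspace_diff hol.subspace_scale)
      moreover have "\<omega> \<beta> < n" if \<beta>: "\<beta> \<in> Poly_Mapping.keys ?f" for \<beta>
      proof -
        have "\<beta> \<in> Poly_Mapping.keys f \<union> Poly_Mapping.keys (g \<alpha>)"
          using \<beta> by (auto simp: in_keys_iff lookup_minus)
        then have "\<omega> \<beta> \<le> n" "\<beta> \<in> K"
          using Suc.prems g\<alpha> V(2) by (auto simp: less_Suc_eq_le)
        moreover have "\<beta> \<noteq> \<alpha>" using \<beta> g\<alpha>(2) by (auto simp: in_keys_iff lookup_minus)
        ultimately show ?thesis using K(2) \<alpha> V(2)[OF Suc.prems(1)] by (metis inj_onD le_neq_implies_less subsetD)
      qed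
      ultimately have "?f \<in> hol.span (g ` ?L)" by (rule Suc.IH)
      moreover have "hol_scale ?c (g \<alpha>) \<in> hol.span (g ` ?L)"
        using L by (intro hol.span_scale hol.span_base) auto
      ultimately have "?f + hol_scale ?c (g \<alpha>) \<in> hol.span (g ` ?L)" by (rule hol.span_add)
      then show ?thesis by simp
    qed
  qed
  have "T \<subseteq> hol.span (g ` ?L)"
  proof
    fix f assume "f \<in> T"
    then have "f \<in> V" using T(2) by auto
    then show "f \<in> hol.span (g ` ?L)"
      by (rule span[of _ "Suc (Max (\<omega> ` Poly_Mapping.keys f))"]) (simp add: less_Suc_eq_le)
  qed
  then have "card T \<le> card (g ` ?L)"
    using hol.independent_span_bound[of "g ` ?L" T] T(1) finL by auto
  also have "\<dots> \<le> card ?L" by (rule card_image_le[OF finL])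
  finally show ?thesis .
qed

text \<open>\<open>hol.independent\<close> speaks of sets, and a repeated member would disappear in
  the image. The coefficients 1 and -1 at two equal members rule this out.\<close>

lemma independent_family:
  fixes g :: "'a \<Rightarrow> 'n hol_poly"
  assumes I: "finite I" and indep: "\<And>c. (\<Sum>i\<in>I. hol_scale (c i) (g i)) = 0 \<Longrightarrow> \<forall>i\<in>I. c i = 0"
  shows "inj_on g I" "hol.independent (g ` I)"
proof -
  show inj: "inj_on g I"
  proof (rule inj_onI, rule ccontr)
    fix i j assume ij: "i \<in> I" "j \<in> I" "g i = g j" "i \<noteq> j"
    let ?c = "\<lambda>k. if k = i then 1 else if k = j then - 1 else (0 :: complex)"
    have "(\<Sum>k\<in>I. hol_scale (?c k) (g k)) = (\<Sum>k\<in>I - {i} - {j}. hol_scale (?c k) (g k))"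
      using I ij by (simp add: sum.remove[of I i] sum.remove[of "I - {i}" j])
    also have "\<dots> = 0" by (rule sum.neutral) auto
    finally have "\<forall>k\<in>I. ?c k = 0" by (rule indep)
    from bspec[OF this ij(1)] show False by simp
  qed
  show "hol.independent (g ` I)"
  proof (rule hol.independent_if_scalars_zero)
    fix c x assume "(\<Sum>x\<in>g ` I. hol_scale (c x) x) = 0" "x \<in> g ` I"
    then show "c x = 0" using indep[of "c \<circ> g"] by (auto simp: sum.reindex[OF inj])
  qed (use I in simp)
qed

text \<open>Polynomials with distinct leading monomials are independent: in a vanishing combination,
  the heaviest leading monomial with nonzero coefficient occurs in only one of the summands that
  count.\<close>

lemma card_leads_le:
  fixes \<omega> :: "'n::finite monom \<Rightarrow> nat"
  assumes L: "finite L" "inj_on \<omega> L" "\<And>\<alpha>. \<alpha> \<in> L \<Longrightarrow> \<exists>f \<in> hol.span X. is_lead \<omega> \<alpha> f"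
    and X: "finite X"
  shows "card L \<le> card X"
proof -
  obtain g where g: "\<And>\<alpha>. \<alpha> \<in> L \<Longrightarrow> g \<alpha> \<in> hol.span X \<and> is_lead \<omega> \<alpha> (g \<alpha>)"
    using bchoice[of L "\<lambda>\<alpha> f. f \<in> hol.span X \<and> is_lead \<omega> \<alpha> f"] L(3) by auto
  have indep: "\<forall>\<alpha>\<in>L. c \<alpha> = 0" if "(\<Sum>\<alpha>\<in>L. hol_scale (c \<alpha>) (g \<alpha>)) = 0" for c
  proof (rule ccontr)
    assume "\<not> (\<forall>\<alpha>\<in>L. c \<alpha> = 0)"
    let ?N = "{\<alpha> \<in> L. c \<alpha> \<noteq> 0}"
    have N: "finite (\<omega> ` ?N)" "\<omega> ` ?N \<noteq> {}" using L(1) \<open>\<not> _\<close> by auto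
    obtain \<alpha> where \<alpha>: "\<alpha> \<in> ?N" "\<omega> \<alpha> = Max (\<omega> ` ?N)" using Max_in[OF N] by auto
    have le: "\<omega> \<beta> \<le> \<omega> \<alpha>" if "\<beta> \<in> ?N" for \<beta> unfolding \<alpha>(2) using that N(1) by (intro Max_ge) auto
    have "c \<beta> * Poly_Mapping.lookup (g \<beta>) \<alpha> = 0" if \<beta>: "\<beta> \<in> L - {\<alpha>}" for \<beta>
    proof (cases "c \<beta> = 0")
      case False
      then have "\<omega> \<beta> \<le> \<omega> \<alpha>" using le \<beta> by auto
      moreover have "\<omega> \<beta> \<noteq> \<omega> \<alpha>" using L(2) \<alpha>(1) \<beta> by (auto simp: inj_on_def)
      ultimately have "\<alpha> \<notin> Poly_Mapping.keys (g \<beta>)" using g[of \<beta>] \<beta> by (auto simp: is_lead_def)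
      then show ?thesis by (simp add: in_keys_iff)
    qed simp
    then have "(\<Sum>\<beta>\<in>L - {\<alpha>}. c \<beta> * Poly_Mapping.lookup (g \<beta>) \<alpha>) = 0"
      by (rule sum.neutral[OF ballI])
    then have "(\<Sum>\<beta>\<in>L. c \<beta> * Poly_Mapping.lookup (g \<beta>) \<alpha>) = c \<alpha> * Poly_Mapping.lookup (g \<alpha>) \<alpha>"
      using L(1) \<alpha>(1) by (subst sum.remove[of _ \<alpha>]) auto
    moreover have "(\<Sum>\<beta>\<in>L. c \<beta> * Poly_Mapping.lookup (g \<beta>) \<alpha>) = 0"
      using arg_cong[OF that, of "\<lambda>f. Poly_Mapping.lookup f \<alpha>"] by (simp add: lookup_sum)
    ultimately show False using \<alpha>(1) g[of \<alpha>] by (auto simp: is_lead_def in_keys_iff)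
  qed
  from independent_family[OF L(1), of g] indep have inj: "inj_on g L" and "hol.independent (g ` L)" by blast+
  moreover have "g ` L \<subseteq> hol.span X" using g by auto
  ultimately have "card (g ` L) \<le> card X" using hol.independent_span_bound[OF X] by blast
  then show ?thesis by (simp add: card_image[OF inj])
qed

lemma is_lead_mult_monom:
  assumes "\<And>\<alpha> \<beta>. \<omega> (\<alpha> + \<beta>) = \<omega> \<alpha> + \<omega> \<beta>" "is_lead \<omega> \<alpha> f"
  shows "is_lead \<omega> (\<mu> + \<alpha>) (mult_monom \<mu> f)"
  using assms by (auto simp: is_lead_def keys_mult_monom)

lemma radix_sum_inj:
  fixes f g :: "nat \<Rightarrow> nat"
  assumes "\<And>i. i < n \<Longrightarrow> f i < D" "\<And>i. i < n \<Longrightarrow> g i < D" "(\<Sum>i<n. f i * D ^ i) = (\<Sum>i<n. g i * D ^ i)" "i < n"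
  shows "f i = g i"
  using assms
proof (induction n arbitrary: f g i)
  case (Suc n)
  have split: "(\<Sum>i<Suc n. h i * D ^ i) = h 0 + D * (\<Sum>i<n. h (Suc i) * D ^ i)" for h :: "nat \<Rightarrow> nat"
    unfolding sum.lessThan_Suc_shift by (simp add: sum_distrib_left mult_ac)
  have f0: "f 0 < D" "g 0 < D" using Suc.prems by auto
  have eq: "f 0 + D * (\<Sum>i<n. f (Suc i) * D ^ i) = g 0 + D * (\<Sum>i<n. g (Suc i) * D ^ i)"
    using Suc.prems(3) unfolding split .
  from arg_cong[OF eq, of "\<lambda>x. x mod D"] f0 have "f 0 = g 0" by simp
  moreover from arg_cong[OF eq, of "\<lambda>x. x div D"] f0
  have "(\<Sum>i<n. f (Suc i) * D ^ i) = (\<Sum>i<n. g (Suc i) * D ^ i)" by simp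
  then have "f (Suc j) = g (Suc j)" if "j < n" for j
    using Suc.IH[of "\<lambda>i. f (Suc i)" "\<lambda>i. g (Suc i)" j] Suc.prems(1,2) that by auto
  ultimately show ?case using Suc.prems(4) by (cases i) auto
qed simp

text \<open>The exponents are read as digits in base \<open>Suc D\<close>. The value is additive,
  and on monomials of degree at most \<open>D\<close> all digits are below the base, so it
  determines the monomial.\<close>

lemma ex_monom_weight:
  "\<exists>\<omega> :: 'n::finite monom \<Rightarrow> nat. (\<forall>\<alpha> \<beta>. \<omega> (\<alpha> + \<beta>) = \<omega> \<alpha> + \<omega> \<beta>) \<and> inj_on \<omega> {\<alpha>. mdeg \<alpha> \<le> D}"
proof -
  let ?n = "card (UNIV :: 'n set)"
  obtain e where e: "bij_betw e {..<?n} (UNIV :: 'n set)"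
    using ex_bij_betw_nat_finite[of "UNIV :: 'n set"] by (auto simp: lessThan_atLeast0)
  let ?w = "\<lambda>\<alpha> :: 'n monom. \<Sum>i<?n. Poly_Mapping.lookup \<alpha> (e i) * Suc D ^ i"
  have "inj_on ?w {\<alpha>. mdeg \<alpha> \<le> D}"
  proof (rule inj_onI)
    fix \<alpha> \<beta> :: "'n monom" assume ab: "\<alpha> \<in> {\<alpha>. mdeg \<alpha> \<le> D}" "\<beta> \<in> {\<alpha>. mdeg \<alpha> \<le> D}" "?w \<alpha> = ?w \<beta>"
    have lt: "Poly_Mapping.lookup \<gamma> i < Suc D" if "mdeg \<gamma> \<le> D" for \<gamma> :: "'n monom" and i
      using member_le_sum[of i UNIV "Poly_Mapping.lookup \<gamma>"] that by (simp add: mdeg_def)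
    show "\<alpha> = \<beta>"
    proof (rule poly_mapping_eqI)
      fix k
      obtain i where i: "i < ?n" "k = e i" using e by (auto simp: bij_betw_def image_iff)
      show "Poly_Mapping.lookup \<alpha> k = Poly_Mapping.lookup \<beta> k"
        unfolding i(2) using ab lt by (intro radix_sum_inj[OF _ _ ab(3) i(1)]) auto
    qed
  qed
  moreover have "?w (\<alpha> + \<beta>) = ?w \<alpha> + ?w \<beta>" for \<alpha> \<beta>
    by (simp add: lookup_add add_mult_distrib sum.distrib)
  ultimately show ?thesis by (intro exI[of _ ?w] conjI allI)
qed

text \<open>The span of the \<open>m k\<close> has at least \<open>card K\<close> leading monomials.
  Their products with words of length \<open>l\<close> are leading monomials of elements of
  \<open>hol.span X\<close>, and the growth theorem bounds the number of these products from
  below.\<close>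

lemma macaulay_span_bound:
  fixes m :: "'k \<Rightarrow> 'n::finite hol_poly"
  assumes K: "finite K" "inj_on m K" "hol.independent (m ` K)"
    and deg: "\<And>k. k \<in> K \<Longrightarrow> Poly_Mapping.keys (m k) \<subseteq> {\<alpha>. mdeg \<alpha> = d}"
    and N: "card (UNIV :: 'n set) = Suc N"
    and X: "finite X" "\<And>k w. k \<in> K \<Longrightarrow> length w = l \<Longrightarrow> mult_monom (word_monom w) (m k) \<in> hol.span X"
    and a: "1 \<le> \<delta>" "strict_mono_on {\<delta>..N} a" "\<forall>j\<in>{\<delta>..N}. j \<le> a j"
      "card K = (\<Sum>j=\<delta>..N. a j choose j)"
  shows "(\<Sum>j=\<delta>..N. (a j + l) choose j) \<le> card X"
proof -
  obtain \<omega> :: "'n monom \<Rightarrow> nat" where \<omega>: "\<And>\<alpha> \<beta>. \<omega> (\<alpha> + \<beta>) = \<omega> \<alpha> + \<omega> \<beta>" "inj_on \<omega> {\<alpha>. mdeg \<alpha> \<le> d + l}"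
    using ex_monom_weight by blast
  let ?V = "hol.span (m ` K)"
  have V_deg: "Poly_Mapping.keys f \<subseteq> {\<alpha>. mdeg \<alpha> = d}" if "f \<in> ?V" for f
  proof -
    have sub: "hol.subspace {f :: 'n hol_poly. Poly_Mapping.keys f \<subseteq> {\<alpha>. mdeg \<alpha> = d}}"
      by (intro hol.subspaceI) (auto simp: in_keys_iff lookup_add subset_iff, metis add_0)
    show ?thesis using hol.span_minimal[OF _ sub, of "m ` K"] deg that by auto
  qed
  define L where "L = {\<alpha>. \<exists>f\<in>?V. is_lead \<omega> \<alpha> f}"
  have L: "L \<subseteq> {\<alpha>. mdeg \<alpha> = d}" using V_deg by (auto simp: L_def is_lead_def)
  have "card (m ` K) \<le> card L"
    unfolding L_def
    by (rule card_independent_le_leads[OF hol.subspace_span V_deg finite_monoms_of_degree _ K(3) hol.span_superset])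
      (auto intro: inj_on_subset[OF \<omega>(2)])
  then have cardL: "card K \<le> card L" by (simp add: card_image[OF K(2)])
  let ?lk = "Poly_Mapping.lookup :: 'n monom \<Rightarrow> 'n \<Rightarrow> nat"
  have inj_lk: "inj_on ?lk S" for S by (rule inj_onI) simp
  define B where "B = ?lk ` L"
  have "finite L" using finite_subset[OF L finite_monoms_of_degree] .
  then have B: "finite B" "B \<subseteq> exps UNIV d" "card B = card L"
    using L by (auto simp: B_def exps_def mdeg_def card_image[OF inj_lk])
  have word: "\<exists>w \<alpha>. length w = j \<and> \<alpha> \<in> L \<and> u = ?lk (word_monom w + \<alpha>)" if "u \<in> (up UNIV ^^ j) B" for u j
    using that
  proof (induction j arbitrary: u)
    case 0
    then obtain \<alpha> where "\<alpha> \<in> L" "u = ?lk \<alpha>" by (auto simp: B_def)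
    then show ?case by (intro exI[of _ "[]"] exI[of _ \<alpha>]) simp
  next
    case (Suc j)
    then have "u \<in> up UNIV ((up UNIV ^^ j) B)" by simp
    then obtain i v where iv: "v \<in> (up UNIV ^^ j) B" "u = inc i v"
      unfolding up_def[of UNIV "(up UNIV ^^ j) B"] by blast
    from Suc.IH[OF iv(1)] obtain w \<alpha> where w: "length w = j" "\<alpha> \<in> L" "v = ?lk (word_monom w + \<alpha>)" by blast
    have "u = ?lk (word_monom (i # w) + \<alpha>)"
      by (rule ext) (simp add: iv(2) w(3) inc_apply lookup_add lookup_single)
    then show ?case using w by (intro exI[of _ "i # w"] exI[of _ \<alpha>]) simp
  qed
  \<comment> \<open>This pulls the iterated shadow back to the type of monomials, where each element
    is a word of length \<open>l\<close> times a leading monomial.\<close>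
  define L' where "L' = {\<gamma>. ?lk \<gamma> \<in> (up UNIV ^^ l) B}"
  have L': "\<exists>w \<alpha>. length w = l \<and> \<alpha> \<in> L \<and> \<gamma> = word_monom w + \<alpha>" if "\<gamma> \<in> L'" for \<gamma>
    using word[of "?lk \<gamma>" l] that by (simp add: L'_def)
  have L'_deg: "L' \<subseteq> {\<alpha>. mdeg \<alpha> = d + l}"
    using L' L by (fastforce simp: mdeg_add mdeg_word_monom)
  have image: "?lk ` L' = (up UNIV ^^ l) B"
    using word by (force simp: L'_def)
  have "(\<Sum>j=\<delta>..N. (a j + l) choose j) \<le> card ((up UNIV ^^ l) B)"
    using finite_UNIV N B(1,2) a(1,2,3)
    by (rule card_iterated_up_ge_macaulay) (use a(4) cardL B(3) in simp)
  also have "\<dots> = card L'" unfolding image[symmetric] by (rule card_image[OF inj_lk])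
  also have "\<dots> \<le> card X"
  proof (rule card_leads_le[OF _ _ _ X(1), of _ \<omega>])
    show "finite L'" using finite_subset[OF L'_deg finite_monoms_of_degree] .
    show "inj_on \<omega> L'" by (rule inj_on_subset[OF \<omega>(2)]) (use L'_deg in auto)
    fix \<gamma> assume "\<gamma> \<in> L'"
    then obtain w \<alpha> where w: "length w = l" "\<alpha> \<in> L" "\<gamma> = word_monom w + \<alpha>" using L' by blast
    then obtain f where f: "f \<in> ?V" "is_lead \<omega> \<alpha> f" by (auto simp: L_def)
    interpret mm: Modules.module_hom hol_scale hol_scale "mult_monom (word_monom w)" by (rule mult_monom_linear)
    have "mult_monom (word_monom w) f \<in> hol.span (mult_monom (word_monom w) ` m ` K)"
      using f(1) mm.span_image by blast
    also have "\<dots> \<subseteq> hol.span X"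
      using X(2) w(1) by (intro hol.span_minimal hol.subspace_span) auto
    finally show "\<exists>f\<in>hol.span X. is_lead \<omega> \<gamma> f"
      using is_lead_mult_monom[of \<omega>, OF \<omega>(1) f(2), of "word_monom w"] w(3) by blast
  qed
  finally show ?thesis .
qed

section \<open>The rank estimate\<close>

text \<open>Diagonalising the coefficient matrix by a unitary matrix gives one square for each
  nonzero eigenvalue, with its sign. \<open>P\<close> and \<open>Q\<close> are the index sets of the
  positive and the negative ones.\<close>

lemma hermitian_poly_decomposition:
  fixes M :: "'n::finite mixed_poly"
  assumes "hermitian_poly M" "bihomogeneous d M" "signature d M = (p, q)"
  obtains m :: "nat \<Rightarrow> 'n hol_poly" and P Q where
    "finite P" "finite Q" "P \<inter> Q = {}" "card P = p" "card Q = q"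
    "\<And>k. Poly_Mapping.keys (m k) \<subseteq> {\<alpha>. mdeg \<alpha> = d}"
    "inj_on m (P \<union> Q)" "hol.independent (m ` (P \<union> Q))"
    "\<And>z. eval_mixed M z = of_real ((\<Sum>k\<in>P. (cmod (eval_hol (m k) z))\<^sup>2) - (\<Sum>k\<in>Q. (cmod (eval_hol (m k) z))\<^sup>2))"
proof -
  define ms where "ms = (monom_list d :: 'n monom list)"
  have ms: "distinct ms" "set ms = {\<alpha>. mdeg \<alpha> = d}" unfolding ms_def by (rule monom_list)+
  let ?N = "length ms"
  have bij: "bij_betw ((!) ms) {..<?N} (set ms)" by (rule bij_betw_nth[OF ms(1) refl refl])
  define A where "A = coeff_mat d M"
  have A: "A \<in> carrier_mat ?N ?N" by (simp add: A_def coeff_mat_def ms_def Let_def)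
  have A_entry: "A $$ (i, j) = Poly_Mapping.lookup M (ms ! j, ms ! i)" if "i < ?N" "j < ?N" for i j
    using that by (simp add: A_def coeff_mat_def ms_def Let_def)
  have herm: "adj A = A"
  proof (rule eq_matI)
    fix i j assume "i < dim_row A" "j < dim_col A"
    then have "i < ?N" "j < ?N" using A by auto
    then show "adj A $$ (i, j) = A $$ (i, j)"
      by (simp add: index_adj[OF A] A_entry flip: hermitian_coeffs[OF assms(1)])
  qed (use A in \<open>auto simp: adj_def\<close>)
  obtain U \<mu> where U: "U \<in> carrier_mat ?N ?N" "adj U * U = 1\<^sub>m ?N" "A = U * real_diag ?N \<mu> * adj U"
    "char_poly A = (\<Prod>k<?N. [:- of_real (\<mu> k), 1:])"
    using hermitian_spectral[OF A herm] by blast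
  have aU: "adj U \<in> carrier_mat ?N ?N" by (rule adj_carrier[OF U(1)])
  have D: "real_diag ?N \<mu> \<in> carrier_mat ?N ?N" by (simp add: real_diag_def)
  have orth: "(\<Sum>j<?N. cnj (U $$ (j, k)) * U $$ (j, i)) = (if k = i then 1 else 0)" if "k < ?N" "i < ?N" for i k
    using arg_cong[OF U(2), of "\<lambda>X. X $$ (k, i)"] index_mult_sum[OF aU U(1) that] index_adj[OF U(1)] that
    by simp
  have A_sum: "A $$ (i, j) = (\<Sum>k<?N. of_real (\<mu> k) * U $$ (i, k) * cnj (U $$ (j, k)))" if "i < ?N" "j < ?N" for i j
  proof -
    have "(U * real_diag ?N \<mu>) $$ (i, k) = of_real (\<mu> k) * U $$ (i, k)" if "k < ?N" for k
    proof -
      have "(U * real_diag ?N \<mu>) $$ (i, k) = (\<Sum>l<?N. if l = k then of_real (\<mu> k) * U $$ (i, k) else 0)"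
        unfolding index_mult_sum[OF U(1) D \<open>i < ?N\<close> that]
        by (rule sum.cong) (use that in \<open>auto simp: real_diag_def\<close>)
      then show ?thesis using that by simp
    qed
    then show ?thesis
      unfolding U(3) index_mult_sum[OF mult_carrier_mat[OF U(1) D] aU that]
      using index_adj[OF U(1) _ that(2)] by simp
  qed
  \<comment> \<open>The coefficients of \<open>m k\<close> are those of row \<open>k\<close> of
    \<open>adj U\<close> applied to the monomial vector, because rows of \<open>coeff_mat\<close>
    belong to conjugated monomials. The factor \<open>s k\<close> absorbs the absolute value of the
    eigenvalue and leaves only its sign.\<close>
  define s where "s k = complex_of_real (sqrt \<bar>\<mu> k\<bar>)" for k
  define m where "m k = (\<Sum>j<?N. hol_scale (s k * cnj (U $$ (j, k))) (Poly_Mapping.single (ms ! j) 1))" for k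
  have lookup_m: "Poly_Mapping.lookup (m k) (ms ! j) = s k * cnj (U $$ (j, k))" if "j < ?N" for j k
  proof -
    have "Poly_Mapping.lookup (m k) (ms ! j) = (\<Sum>i<?N. if i = j then s k * cnj (U $$ (j, k)) else 0)"
      unfolding m_def lookup_sum
      by (rule sum.cong) (use that ms(1) in \<open>auto simp: lookup_single when_def nth_eq_iff_index_eq\<close>)
    then show ?thesis using that by simp
  qed
  have keys_m: "Poly_Mapping.keys (m k) \<subseteq> set ms" for k
  proof
    fix \<alpha> assume \<alpha>: "\<alpha> \<in> Poly_Mapping.keys (m k)"
    show "\<alpha> \<in> set ms"
    proof (rule ccontr)
      assume "\<alpha> \<notin> set ms"
      then have "ms ! j \<noteq> \<alpha>" if "j < ?N" for j using that by auto
      then have "Poly_Mapping.lookup (m k) \<alpha> = 0"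
        unfolding m_def lookup_sum by (intro sum.neutral) (simp add: lookup_single when_def)
      then show False using \<alpha> by (simp add: in_keys_iff)
    qed
  qed
  have eval_m: "eval_hol (m k) z = s k * (\<Sum>j<?N. cnj (U $$ (j, k)) * eval_monom (ms ! j) z)" for k z
  proof -
    have "eval_hol (m k) z = (\<Sum>j<?N. Poly_Mapping.lookup (m k) (ms ! j) * eval_monom (ms ! j) z)"
      unfolding eval_hol_superset[OF finite_set keys_m] by (rule sum.reindex_bij_betw[OF bij, symmetric])
    then show ?thesis by (simp add: lookup_m sum_distrib_left mult_ac)
  qed
  define P where "P = {k. k < ?N \<and> 0 < \<mu> k}"
  define Q where "Q = {k. k < ?N \<and> \<mu> k < 0}"
  have PQ: "finite P" "finite Q" "P \<inter> Q = {}" by (auto simp: P_def Q_def)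
  have "card P = p" "card Q = q"
    using assms(3) sum_order_eigenvalues[OF A U(4), of "\<lambda>r. 0 < r"] sum_order_eigenvalues[OF A U(4), of "\<lambda>r. r < 0"]
    by (simp_all add: signature_def num_pos_eigenvalues_def num_neg_eigenvalues_def P_def Q_def A_def)
  have indep: "\<forall>i\<in>P \<union> Q. c i = 0" if "(\<Sum>k\<in>P \<union> Q. hol_scale (c k) (m k)) = 0" for c
  proof
    fix i assume i: "i \<in> P \<union> Q"
    have "(\<Sum>k\<in>P \<union> Q. c k * (s k * cnj (U $$ (j, k)))) = 0" if "j < ?N" for j
      using arg_cong[OF \<open>_ = 0\<close>, of "\<lambda>f. Poly_Mapping.lookup f (ms ! j)"] lookup_m[OF that]
      by (simp add: lookup_sum)
    \<comment> \<open>Pairing with column \<open>i\<close> of \<open>U\<close> isolates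
      \<open>c i * s i\<close> by orthonormality, and \<open>s i\<close> is nonzero because
      \<open>\<mu> i\<close> is nonzero on \<open>P \<union> Q\<close>.\<close>
    then have "0 = (\<Sum>j<?N. (\<Sum>k\<in>P \<union> Q. c k * (s k * cnj (U $$ (j, k)))) * U $$ (j, i))" by simp
    also have "\<dots> = (\<Sum>k\<in>P \<union> Q. c k * s k * (\<Sum>j<?N. cnj (U $$ (j, k)) * U $$ (j, i)))"
      unfolding sum_distrib_left sum_distrib_right by (subst sum.swap) (simp add: mult_ac)
    also have "\<dots> = (\<Sum>k\<in>P \<union> Q. if k = i then c i * s i else 0)"
      by (rule sum.cong) (use i orth in \<open>auto simp: P_def Q_def\<close>)
    also have "\<dots> = c i * s i" using PQ i by simp
    finally show "c i = 0" using i by (auto simp: s_def P_def Q_def)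
  qed
  have eval_M: "eval_mixed M z = of_real ((\<Sum>k\<in>P. (cmod (eval_hol (m k) z))\<^sup>2) - (\<Sum>k\<in>Q. (cmod (eval_hol (m k) z))\<^sup>2))" for z
  proof -
    let ?e = "\<lambda>j. eval_monom (ms ! j) z"
    let ?t = "\<lambda>k. \<Sum>j<?N. cnj (U $$ (j, k)) * ?e j"
    have keysM: "Poly_Mapping.keys M \<subseteq> set ms \<times> set ms"
      using assms(2) by (auto simp: bihomogeneous_def ms(2))
    have "eval_mixed M z = (\<Sum>\<alpha>\<in>set ms. \<Sum>\<beta>\<in>set ms. Poly_Mapping.lookup M (\<alpha>, \<beta>) * eval_monom \<alpha> z * cnj (eval_monom \<beta> z))"
      by (subst eval_mixed_superset[OF _ keysM]) (simp_all add: sum.cartesian_product)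
    also have "\<dots> = (\<Sum>j<?N. \<Sum>i<?N. A $$ (i, j) * ?e j * cnj (?e i))"
      unfolding sum.reindex_bij_betw[OF bij, symmetric] by (intro sum.cong refl) (simp add: A_entry)
    also have "\<dots> = (\<Sum>j<?N. \<Sum>i<?N. \<Sum>k<?N. of_real (\<mu> k) * (cnj (U $$ (j, k)) * ?e j) * cnj (cnj (U $$ (i, k)) * ?e i))"
      by (intro sum.cong refl) (simp add: A_sum sum_distrib_left sum_distrib_right mult_ac)
    also have "\<dots> = (\<Sum>k<?N. \<Sum>j<?N. \<Sum>i<?N. of_real (\<mu> k) * (cnj (U $$ (j, k)) * ?e j) * cnj (cnj (U $$ (i, k)) * ?e i))"
      by (subst (2) sum.swap, subst sum.swap) (rule refl)
    also have "\<dots> = (\<Sum>k<?N. of_real (\<mu> k) * (?t k * cnj (?t k)))"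
      unfolding cnj_sum sum_product unfolding sum_distrib_left by (simp only: mult.assoc)
    also have "\<dots> = of_real (\<Sum>k<?N. \<mu> k * (cmod (?t k))\<^sup>2)"
      by (simp only: of_real_sum of_real_mult complex_norm_square)
    also have "(\<Sum>k<?N. \<mu> k * (cmod (?t k))\<^sup>2) = (\<Sum>k\<in>P \<union> Q. \<mu> k * (cmod (?t k))\<^sup>2)"
      by (rule sum.mono_neutral_right) (auto simp: P_def Q_def)
    also have "\<dots> = (\<Sum>k\<in>P. \<mu> k * (cmod (?t k))\<^sup>2) + (\<Sum>k\<in>Q. \<mu> k * (cmod (?t k))\<^sup>2)"
      by (rule sum.union_disjoint[OF PQ])
    also have "(\<Sum>k\<in>P. \<mu> k * (cmod (?t k))\<^sup>2) = (\<Sum>k\<in>P. (cmod (eval_hol (m k) z))\<^sup>2)"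
      by (rule sum.cong) (auto simp: P_def eval_m s_def norm_mult power_mult_distrib)
    also have "(\<Sum>k\<in>Q. \<mu> k * (cmod (?t k))\<^sup>2) = - (\<Sum>k\<in>Q. (cmod (eval_hol (m k) z))\<^sup>2)"
      unfolding sum_negf[symmetric]
      by (rule sum.cong) (auto simp: Q_def eval_m s_def norm_mult power_mult_distrib)
    finally show ?thesis by simp
  qed
  show thesis
  proof (rule that[OF PQ \<open>card P = p\<close> \<open>card Q = q\<close> _ _ _ eval_M])
    show "inj_on m (P \<union> Q)" "hol.independent (m ` (P \<union> Q))"
      using independent_family[of "P \<union> Q" m] PQ indep by blast+
  qed (use keys_m ms(2) in auto)
qed

section \<open>Evaluation of the Macaulay shift\<close>

lemma ex_macaulay_rep:
  assumes "1 \<le> A" "1 \<le> N"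
  shows "\<exists>\<delta> a. macaulay_rep A N \<delta> a"
proof -
  obtain \<delta> a where *: "1 \<le> \<delta>" "\<delta> \<le> N" "strict_mono_on {\<delta>..N} a" "\<forall>j\<in>{\<delta>..N}. j \<le> a j"
    "A = (\<Sum>j=\<delta>..N. a j choose j)"
    using ex_macaulay_sum[OF assms(2,1)] by blast
  have "\<delta> \<le> a \<delta>" by (rule bspec[OF *(4)]) (simp add: *(2))
  then have "0 < a \<delta>" using *(1) by linarith
  with * have "macaulay_rep A N \<delta> a" by (simp add: macaulay_rep_def)
  then show ?thesis by blast
qed

text \<open>Existence guarantees that the pair picked by \<open>SOME\<close> is a representation.
  Its tops satisfy \<open>j \<le> a j\<close>, so \<open>int_binom\<close> takes its ordinary value
  on every term.\<close>

lemma macaulay_shift_eq: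
  assumes "1 \<le> A" "1 \<le> N"
  obtains \<delta> a where "macaulay_rep A N \<delta> a"
    "macaulay_shift A N 0 (int l) = (\<Sum>j=\<delta>..N. (a j + l) choose j)"
proof -
  obtain \<delta> a where eq: "(SOME (\<delta>, a). macaulay_rep A N \<delta> a) = (\<delta>, a)" by (meson surj_pair)
  have "(\<lambda>(\<delta>, a). macaulay_rep A N \<delta> a) (SOME (\<delta>, a). macaulay_rep A N \<delta> a)"
    using ex_macaulay_rep[OF assms] by (intro someI_ex[of "\<lambda>(\<delta>, a). macaulay_rep A N \<delta> a"]) auto
  then have rep: "macaulay_rep A N \<delta> a" unfolding eq by simp
  have "int_binom (int (a j) + int l) (int j) = (a j + l) choose j" if "j \<in> {\<delta>..N}" for j
  proof -
    have "j \<le> a j" using rep that by (auto simp: macaulay_rep_def)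
    then show ?thesis by (simp add: int_binom_def flip: of_nat_add)
  qed
  then have "macaulay_shift A N 0 (int l) = (\<Sum>j=\<delta>..N. (a j + l) choose j)"
    unfolding macaulay_shift_def eq by simp
  then show ?thesis using rep that by blast
qed

theorem theorem4p6:
  fixes M :: "'n::finite mixed_poly"
    and h :: "'n hol_poly list"
    and n l d p q :: nat
  assumes "n = card (UNIV :: 'n set)" and "n \<ge> 2" and "l \<ge> 1"
    and "M \<noteq> 0" and "hermitian_poly M" and "bihomogeneous d M"
    and "signature d M = (p, q)"
    and "\<forall>z. eval_mixed M z * of_real (sqnorm_vec z ^ l) = of_real (sqnorm_map h z)"
  shows "int (macaulay_shift (p + q) (n - 1) 0 (int l)) - int q * int ((n - 1 + l) choose l)
           \<le> int (hol_rank h)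
         \<and> hol_rank h \<le> p * ((n - 1 + l) choose l)"
proof -
  obtain m :: "nat \<Rightarrow> 'n hol_poly" and P Q where
    fin: "finite P" "finite Q" "P \<inter> Q = {}" and card: "card P = p" "card Q = q"
    and deg: "\<And>k. Poly_Mapping.keys (m k) \<subseteq> {\<alpha>. mdeg \<alpha> = d}"
    and indep: "inj_on m (P \<union> Q)" "hol.independent (m ` (P \<union> Q))"
    and M: "\<And>z. eval_mixed M z = of_real ((\<Sum>k\<in>P. (cmod (eval_hol (m k) z))\<^sup>2) - (\<Sum>k\<in>Q. (cmod (eval_hol (m k) z))\<^sup>2))"
    by (rule hermitian_poly_decomposition[OF assms(5,6,7)]) (rule that; assumption)
  define W where "W = {w :: 'n list. length w = l}"
  have W: "finite W" unfolding W_def by (rule finite_words)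
  define f where "f = (\<lambda>(k, w). mult_monom (word_monom w) (m k))"
  \<comment> \<open>\<open>Y\<close> is indexed by monomials, whereas \<open>f\<close> uses words.
    Different words with the same monomial give the same product, so counting by monomials yields
    the factor \<open>(n - 1 + l) choose l\<close> for each \<open>k\<close>.\<close>
  define Y where "Y S = (\<lambda>(k, \<gamma>). mult_monom \<gamma> (m k)) ` (S \<times> {\<gamma>. mdeg \<gamma> = l})" for S
  have fY: "f ` (S \<times> W) \<subseteq> Y S" for S
    by (force simp: f_def Y_def W_def mdeg_word_monom)
  have Y: "finite (Y S)" "card (Y S) \<le> card S * ((n - 1 + l) choose l)" if "finite S" for S
  proof -
    show "finite (Y S)" unfolding Y_def by (intro finite_imageI finite_cartesian_product that finite_monoms_of_degree)
    have "card (Y S) \<le> card (S \<times> {\<gamma> :: 'n monom. mdeg \<gamma> = l})"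
      unfolding Y_def by (intro card_image_le finite_cartesian_product that finite_monoms_of_degree)
    also have "\<dots> \<le> card S * ((n - 1 + l) choose l)"
      unfolding card_cartesian_product assms(1) by (intro mult_le_mono2 card_monoms_of_degree)
    finally show "card (Y S) \<le> card S * ((n - 1 + l) choose l)" .
  qed
  have prod: "(\<Sum>k\<in>S. (cmod (eval_hol (m k) z))\<^sup>2) * sqnorm_vec z ^ l = (\<Sum>i\<in>S \<times> W. (cmod (eval_hol (f i) z))\<^sup>2)"
    for S z
    by (simp add: sqnorm_vec_power W_def f_def sum_product sum.cartesian_product eval_mult_monom norm_mult
        power_mult_distrib case_prod_unfold mult.commute)
  \<comment> \<open>The negative squares are moved to the left. The disjoint sum of index sets
    treats \<open>h\<close> and the products over \<open>Q\<close> as a single family, so that both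
    sides are plain sums of squares.\<close>
  have eq: "(\<Sum>i\<in>{..<length h} <+> (Q \<times> W). (cmod (eval_hol (case_sum ((!) h) f i) z))\<^sup>2)
      = (\<Sum>i\<in>P \<times> W. (cmod (eval_hol (f i) z))\<^sup>2)" for z
  proof -
    have "complex_of_real (sqnorm_map h z) = of_real (((\<Sum>k\<in>P. (cmod (eval_hol (m k) z))\<^sup>2) -
        (\<Sum>k\<in>Q. (cmod (eval_hol (m k) z))\<^sup>2)) * sqnorm_vec z ^ l)"
      by (simp only: of_real_mult M[symmetric] assms(8)[rule_format])
    then have "sqnorm_map h z = ((\<Sum>k\<in>P. (cmod (eval_hol (m k) z))\<^sup>2) -
        (\<Sum>k\<in>Q. (cmod (eval_hol (m k) z))\<^sup>2)) * sqnorm_vec z ^ l"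
      by (simp only: of_real_eq_iff)
    then show ?thesis
      using fin W by (simp add: sum.Plus left_diff_distrib prod sqnorm_map_def)
  qed
  have image: "case_sum ((!) h) f ` ({..<length h} <+> (Q \<times> W)) = set h \<union> f ` (Q \<times> W)"
    by (auto simp: Plus_def image_Un image_image set_conv_nth)
  have upper: "set h \<union> f ` (Q \<times> W) \<subseteq> hol.span (f ` (P \<times> W))"
    unfolding image[symmetric] by (rule span_of_sqnorm_eq[OF _ _ eq]) (use fin W in auto)
  have lower: "f ` (P \<times> W) \<subseteq> hol.span (set h \<union> f ` (Q \<times> W))"
    unfolding image[symmetric] by (rule span_of_sqnorm_eq[OF _ _ eq[symmetric]]) (use fin W in auto)
  have "set h \<subseteq> hol.span (Y P)"
    using order_trans[OF upper hol.span_mono[OF fY]] by simp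
  then have "hol_rank h \<le> card (Y P)"
    unfolding hol_rank_def hol.dim_span by (rule hol.dim_le_card[OF _ Y(1)[OF fin(1)]])
  then have R_upper: "hol_rank h \<le> p * ((n - 1 + l) choose l)"
    using Y(2)[OF fin(1)] card(1) by simp
  \<comment> \<open>Replacing \<open>h\<close> by a basis of its span makes the cardinality equal to
    the rank, which bounds the size of the spanning set \<open>?X\<close>.\<close>
  obtain H where H: "H \<subseteq> set h" "set h \<subseteq> hol.span H" "card H = hol.dim (set h)"
    by (rule hol.basis_exists[of "set h"])
  have finH: "finite H" using H(1) finite_subset by blast
  let ?X = "H \<union> Y Q"
  have "hol.span (set h \<union> f ` (Q \<times> W)) \<subseteq> hol.span ?X"
  proof (intro hol.span_minimal hol.subspace_span Un_least)
    show "set h \<subseteq> hol.span ?X" by (rule order_trans[OF H(2) hol.span_mono]) simp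
    show "f ` (Q \<times> W) \<subseteq> hol.span ?X" by (rule order_trans[OF _ hol.span_superset]) (rule le_supI2[OF fY])
  qed
  \<comment> \<open>Products over \<open>P\<close> lie in the span by \<open>lower\<close>, and
    those over \<open>Q\<close> are among its generators.\<close>
  then have X: "f ` ((P \<union> Q) \<times> W) \<subseteq> hol.span ?X"
    using lower hol.span_superset[of "set h \<union> f ` (Q \<times> W)"]
    unfolding Sigma_Un_distrib1 image_Un by (meson Un_least Un_subset_iff order_trans)
  have cardX: "card ?X \<le> hol_rank h + q * ((n - 1 + l) choose l)"
    using card_Un_le[of H "Y Q"] Y(2)[OF fin(2)] card(2) H(3) unfolding hol_rank_def hol.dim_span by simp
  \<comment> \<open>A Macaulay representation requires \<open>p + q\<close> to be positive. If both
    index sets were empty, \<open>M\<close> would vanish as a function, hence in all its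
    coefficients.\<close>
  have "P \<union> Q \<noteq> {}"
  proof
    assume "P \<union> Q = {}"
    then have z: "eval_mixed M z = 0" for z using M[of z] by simp
    have "Poly_Mapping.lookup M (\<alpha>, \<beta>) = 0" for \<alpha> \<beta>
    proof (cases "(\<alpha>, \<beta>) \<in> Poly_Mapping.keys M")
      case True
      have "sum (Poly_Mapping.lookup M) {k \<in> Poly_Mapping.keys M. fst k = \<alpha> \<and> snd k = \<beta>} = 0"
        by (rule sum_mixed_monomials_eq_0) (use z in \<open>simp_all add: eval_mixed_def case_prod_unfold\<close>)
      moreover have "{k \<in> Poly_Mapping.keys M. fst k = \<alpha> \<and> snd k = \<beta>} = {(\<alpha>, \<beta>)}" using True by auto
      ultimately show ?thesis by simp
    qed (simp add: in_keys_iff)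
    then have "M = 0" by (intro poly_mapping_eqI) auto
    then show False using assms(4) by simp
  qed
  then have A: "1 \<le> p + q"
    using card fin(1,2) by (auto simp: Suc_le_eq card_gt_0_iff)
  obtain \<delta> a where rep: "macaulay_rep (p + q) (n - 1) \<delta> a"
    and shift: "macaulay_shift (p + q) (n - 1) 0 (int l) = (\<Sum>j=\<delta>..n - 1. (a j + l) choose j)"
    by (rule macaulay_shift_eq[OF A, of "n - 1" l]) (use assms(2) in auto)
  have "(\<Sum>j=\<delta>..n - 1. (a j + l) choose j) \<le> card ?X"
  proof (rule macaulay_span_bound[OF _ indep deg])
    show "mult_monom (word_monom w) (m k) \<in> hol.span ?X" if "k \<in> P \<union> Q" "length w = l" for k w
      using X that by (force simp: f_def W_def)
    show "card (P \<union> Q) = (\<Sum>j=\<delta>..n - 1. a j choose j)"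
      using rep card card_Un_disjoint[OF fin] by (simp add: macaulay_rep_def)
  qed (use rep fin finH Y(1) assms(1,2) in \<open>auto simp: macaulay_rep_def\<close>)
  then have "macaulay_shift (p + q) (n - 1) 0 (int l) \<le> hol_rank h + q * ((n - 1 + l) choose l)"
    using shift cardX by simp
  then have "int (macaulay_shift (p + q) (n - 1) 0 (int l)) - int q * int ((n - 1 + l) choose l) \<le> int (hol_rank h)"
    by (simp flip: of_nat_mult of_nat_add)
  then show ?thesis using R_upper by simp
qed

end
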